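(* Assume GCH. If $X$ is a homogeneous compactum and $p\in X$, then $\mathrm{Escape}(p,X)$ is a closed initial segment of the infinite cardinals with maximum $\chi(p,X)$.
   Context: GCH is the generalized continuum hypothesis. A compactum is a compact Hausdorff space. A space $X$ is homogeneous if for all $p,q\in X$ there is an autohomeomorphism $h$ of $X$ with $h(p)=q$. A neighborhood of $p$ is a set $U\subseteq X$ with $p$ in its interior. The character $\chi(p,X)$ is the cofinality of the set of neighborhoods of $p$ ordered by $\supseteq$ (equivalently, the least cardinality of a local base at $p$). An escape sequence at $p$ is a transfinite sequence of neighborhoods $U_0\supseteq U_1\supseteq\cdots\supseteq U_i\supseteq\cdots$ of $p$ such that $\bigcap_i U_i$ is not a neighborhood of $p$. $\mathrm{Escape}(p,X)$ is the set of infinite cardinals $\kappa$ for which $p$ has a $\kappa$-long escape sequence.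
   Formalization: Escape sequences are taken strictly decreasing, since with repetitions allowed the circle (character ω) has one of length ℵ_ω, and the maximum is claimed only for infinite X, since for finite X the set Escape(p,X) is empty. *)

theory Defs
  imports "HOL-Analysis.Analysis"
begin

unbundle cardinal_syntax

text \<open>
  Cardinals are initial well-orders (\<open>Card_order\<close>), compared by \<open>\<le>o\<close>; sets of cardinals
  are sets of such relations, closed under \<open>=o\<close>.
\<close>

text \<open>
  GCH for all cardinals up to that of \<open>'b\<close>: nothing lies strictly between an infinite \<open>|A|\<close> and
  \<open>|Pow A|\<close>. Letting \<open>C\<close> range over \<open>'b set set\<close> loses nothing, since any set smaller than
  \<open>Pow A\<close> injects into it. A hypothesis in HOL cannot quantify over types, so GCH has to be
  assumed at one sufficiently large type.
\<close>

definition GCH :: "'b itself \<Rightarrow> bool" where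
  "GCH _ \<longleftrightarrow>
     (\<forall>A :: 'b set. infinite A \<longrightarrow> (\<nexists>C :: 'b set set. |A| <o |C| \<and> |C| <o |Pow A| ))"

definition compactum :: "'a topology \<Rightarrow> bool" where
  "compactum X \<longleftrightarrow> compact_space X \<and> Hausdorff_space X"

definition homogeneous :: "'a topology \<Rightarrow> bool" where
  "homogeneous X \<longleftrightarrow>
     (\<forall>p \<in> topspace X. \<forall>q \<in> topspace X. \<exists>h. homeomorphic_map X X h \<and> h p = q)"

definition nbhds :: "'a topology \<Rightarrow> 'a \<Rightarrow> 'a set set" where
  "nbhds X p = {U. U \<subseteq> topspace X \<and> p \<in> X interior_of U}"

text \<open>
  Cofinal for reverse inclusion. (The constant \<open>cofinal\<close> of \<open>Main\<close> is a strict variant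
  intended for well-orders.)
\<close>

definition cofinal_nbhds :: "'a topology \<Rightarrow> 'a \<Rightarrow> 'a set set \<Rightarrow> bool" where
  "cofinal_nbhds X p B \<longleftrightarrow> B \<subseteq> nbhds X p \<and> (\<forall>U \<in> nbhds X p. \<exists>V \<in> B. V \<subseteq> U)"

definition character :: "'a topology \<Rightarrow> 'a \<Rightarrow> 'a set rel" where
  "character X p =
     |SOME B. cofinal_nbhds X p B \<and> (\<forall>C. cofinal_nbhds X p C \<longrightarrow> |B| \<le>o |C| )|"

lemma character_attained:
  "\<exists>B. cofinal_nbhds X p B \<and> character X p = |B| \<and> (\<forall>C. cofinal_nbhds X p C \<longrightarrow> |B| \<le>o |C| )"
proof -
  have "cofinal_nbhds X p (nbhds X p)"
    by (auto simp: cofinal_nbhds_def)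
  then have "\<exists>B. cofinal_nbhds X p B \<and> (\<forall>C. cofinal_nbhds X p C \<longrightarrow> |B| \<le>o |C| )"
    using exists_minim_Card_order[of "card_of ` {B. cofinal_nbhds X p B}"]
    by (auto simp: card_of_Card_order)
  from someI_ex[OF this] show ?thesis
    unfolding character_def by blast
qed

text \<open>
  A \<open>\<kappa>\<close>-long escape sequence. The inclusions are proper: if repetitions were allowed, stretching
  an \<open>\<omega>\<close>-long sequence would give, at every non-isolated point of a metric space, escape
  sequences of every length of cofinality \<open>\<omega>\<close>, such as \<open>\<aleph>\<^sub>\<omega>\<close>, so that there would be no largest
  length at all. For regular \<open>\<kappa>\<close> the existence of a \<open>\<kappa>\<close>-long sequence does not depend on
  this choice.
\<close>

definition escape_seq :: "'a topology \<Rightarrow> 'a \<Rightarrow> 'i rel \<Rightarrow> ('i \<Rightarrow> 'a set) \<Rightarrow> bool" where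
  "escape_seq X p \<kappa> U \<longleftrightarrow>
     (\<forall>i \<in> Field \<kappa>. U i \<in> nbhds X p) \<and>
     (\<forall>i j. (i, j) \<in> \<kappa> \<and> i \<noteq> j \<longrightarrow> U j \<subset> U i) \<and>
     (\<Inter>i \<in> Field \<kappa>. U i) \<notin> nbhds X p"

text \<open>
  As \<open>U\<close> is injective on the field of \<open>\<kappa>\<close>, every possible length is realised by a cardinal on
  the type \<open>'a set\<close>.
\<close>

definition Escape :: "'a topology \<Rightarrow> 'a \<Rightarrow> 'a set rel set" where
  "Escape X p = {\<kappa>. Cinfinite \<kappa> \<and> (\<exists>U. escape_seq X p \<kappa> U)}"

definition card_initial_segment :: "'c rel set \<Rightarrow> bool" where
  "card_initial_segment S \<longleftrightarrow>
     (\<forall>\<kappa> \<in> S. Cinfinite \<kappa>) \<and>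
     (\<forall>\<kappa> \<in> S. \<forall>\<mu> :: 'c rel. Cinfinite \<mu> \<and> \<mu> \<le>o \<kappa> \<longrightarrow> \<mu> \<in> S)"

definition card_lub :: "'c rel set \<Rightarrow> 'c rel \<Rightarrow> bool" where
  "card_lub T \<mu> \<longleftrightarrow>
     Card_order \<mu> \<and> (\<forall>\<kappa> \<in> T. \<kappa> \<le>o \<mu>) \<and>
     (\<forall>\<nu> :: 'c rel. Card_order \<nu> \<and> (\<forall>\<kappa> \<in> T. \<kappa> \<le>o \<nu>) \<longrightarrow> \<mu> \<le>o \<nu>)"

definition card_closed :: "'c rel set \<Rightarrow> bool" where
  "card_closed S \<longleftrightarrow> (\<forall>T \<mu>. T \<subseteq> S \<and> T \<noteq> {} \<and> card_lub T \<mu> \<longrightarrow> \<mu> \<in> S)"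

definition card_maximum :: "'c rel set \<Rightarrow> 'c rel \<Rightarrow> bool" where
  "card_maximum S \<mu> \<longleftrightarrow> \<mu> \<in> S \<and> (\<forall>\<kappa> \<in> S. \<kappa> \<le>o \<mu>)"

end

theory Submission
  imports Defs
begin

text \<open>
  Let \<open>\<chi>\<close> be the character of the infinite homogeneous compactum \<open>X\<close>. All three claims follow once
  \<open>Escape X p\<close> is known to be the set of all infinite cardinals \<open>\<kappa> \<le> \<chi>\<close>
  (\<open>escape_le_base\<close> and \<open>escape_of_every_small_length\<close>). If \<open>X\<close> is finite, there are no
  escape sequences at all.

  Both inclusions rest on one cardinality bound, a variant for homogeneous compacta of de la Vega's
  theorem (\<open>homogeneous_card_le\<close>). Let \<open>\<kappa>\<close> be regular with \<open>2\<^bsup>\<mu>\<^esup> \<le> \<kappa>\<close> for all \<open>\<mu> < \<kappa>\<close>,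
  which is what GCH provides. Then \<open>X\<close> has at most \<open>\<kappa>\<close> points if there is no escape sequence of
  length \<open>\<kappa>\<close>, some nonempty intersection of fewer than \<open>\<kappa>\<close> open sets lies in the
  closure of fewer than \<open>\<kappa>\<close> points, and \<open>p\<close> has a local \<open>\<pi>\<close>-base of size less than \<open>\<kappa>\<close>. Indeed a
  closing-off argument in the manner of Pytkeev gives a dense set of size at most \<open>\<kappa>\<close>
  (\<open>small_dense_set\<close>), and a point \<open>q\<close> is determined by the choice of a point of that dense set in each member of the
  \<open>\<pi>\<close>-base moved from \<open>p\<close> to \<open>q\<close> (\<open>homogeneous_card_le_of_dense\<close>).

  Every infinite regular \<open>\<kappa> \<le> \<chi>\<close> is a length. For \<open>\<kappa> = \<omega>\<close> a point of accumulation of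
  a countable set suffices. Let \<open>\<kappa>\<close> be uncountable without escape sequences of length \<open>\<kappa>\<close>. A
  free sequence of length \<open>\<kappa>\<close> would yield one by compactness (\<open>free_seq_escape\<close>), so there is no
  such free sequence. Theorems of Arhangel'skii and Shapirovskii then supply the other two
  hypotheses of the bound (\<open>small_G_in_closure\<close>, \<open>small_local_pi_base\<close>), so that \<open>X\<close> has at most
  \<open>\<kappa>\<close> points. A diagonal form of the Cech--Pospisil theorem finds a point of character less than
  \<open>\<kappa>\<close> (\<open>small_compactum_has_small_G_point\<close>), and homogeneity gives the contradiction \<open>\<chi> < \<kappa>\<close>.

  A singular \<open>\<kappa> \<le> \<chi>\<close> is handled by induction. A sequence whose length is the cofinality of \<open>\<kappa>\<close> is
  stretched to length \<open>\<kappa>\<close>, and its repetitions are made proper by removing, one at a time,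
  points of a set away from \<open>p\<close> that has at least \<open>\<kappa>\<close> elements (\<open>singular_escape\<close>).

  No longer lengths occur. A regular \<open>\<kappa> > \<chi>\<close> is impossible because a bounded part of the sequence
  already deals with every member of a base. In particular there is no sequence of length
  \<open>\<chi>\<^sup>+\<close>, and the bound applies to \<open>\<chi>\<^sup>+\<close>: \<open>X\<close> has at most \<open>\<chi>\<^sup>+\<close> points. As
  the members of an escape sequence decrease properly, its length is at most \<open>|X|\<close>, so a
  length above \<open>\<chi>\<close> could only be the regular cardinal \<open>\<chi>\<^sup>+\<close>.
\<close>

section \<open>Infinite cardinals as index sets\<close>

lemma Cinfinite_Well_order: "Cinfinite \<kappa> \<Longrightarrow> Well_order \<kappa>"
  by (simp add: card_order_on_def)

lemma underS_Field_subset: "underS \<kappa> i \<subseteq> Field \<kappa>"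
  by (auto simp: underS_def Field_def)

lemma wf_minus_Id: "Cinfinite \<kappa> \<Longrightarrow> wf (\<kappa> - Id)"
  using Cinfinite_Well_order well_order_on_def by blast

lemma underS_cases:
  assumes "Cinfinite \<kappa>" "i \<in> Field \<kappa>" "j \<in> Field \<kappa>"
  shows "i \<in> underS \<kappa> j \<or> (j, i) \<in> \<kappa>"
proof -
  have "(i, j) \<in> \<kappa> \<or> (j, i) \<in> \<kappa>"
    using wo_rel.TOTALS[of \<kappa>] Cinfinite_Well_order[OF assms(1)] assms(2,3) wo_rel.intro by blast
  then show ?thesis by (auto simp: underS_def)
qed

lemma Cinfinite_order:
  assumes "Cinfinite \<kappa>"
  shows Cinfinite_refl: "\<And>i. i \<in> Field \<kappa> \<Longrightarrow> (i, i) \<in> \<kappa>"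
    and Cinfinite_trans: "\<And>i j k. (i, j) \<in> \<kappa> \<Longrightarrow> (j, k) \<in> \<kappa> \<Longrightarrow> (i, k) \<in> \<kappa>"
    and Cinfinite_antisym: "\<And>i j. (i, j) \<in> \<kappa> \<Longrightarrow> (j, i) \<in> \<kappa> \<Longrightarrow> i = j"
proof -
  interpret wo_rel \<kappa> using Cinfinite_Well_order[OF assms] by (rule wo_rel.intro)
  show "\<And>i. i \<in> Field \<kappa> \<Longrightarrow> (i, i) \<in> \<kappa>" using REFL by (rule refl_onD)
  show "\<And>i j k. (i, j) \<in> \<kappa> \<Longrightarrow> (j, k) \<in> \<kappa> \<Longrightarrow> (i, k) \<in> \<kappa>" using TRANS by (rule transD)
  show "\<And>i j. (i, j) \<in> \<kappa> \<Longrightarrow> (j, i) \<in> \<kappa> \<Longrightarrow> i = j" using ANTISYM by (rule antisymD)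
qed

lemma underS_trans_eq:
  assumes "Cinfinite \<kappa>" "i \<in> underS \<kappa> j" "(j, k) \<in> \<kappa>"
  shows "i \<in> underS \<kappa> k"
  using assms Cinfinite_trans[OF assms(1)] Cinfinite_antisym[OF assms(1)]
  by (auto simp: underS_def)

lemma trans_underS_eq:
  assumes "Cinfinite \<kappa>" "(i, j) \<in> \<kappa>" "j \<in> underS \<kappa> k"
  shows "i \<in> underS \<kappa> k"
  using assms Cinfinite_trans[OF assms(1)] Cinfinite_antisym[OF assms(1)]
  by (auto simp: underS_def)

lemma Cinfinite_underS_greater:
  assumes "Cinfinite \<kappa>" "i \<in> Field \<kappa>"
  obtains k where "k \<in> Field \<kappa>" "i \<in> underS \<kappa> k"
  using infinite_Card_order_limit[of \<kappa> i] assms by (auto simp: cinfinite_def underS_def)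

lemma finite_subset_has_max:
  assumes "Cinfinite \<kappa>" "finite K" "K \<subseteq> Field \<kappa>" "K \<noteq> {}"
  obtains k where "k \<in> K" "\<And>i. i \<in> K \<Longrightarrow> (i, k) \<in> \<kappa>"
proof -
  have "\<exists>k\<in>K. \<forall>i\<in>K. (i, k) \<in> \<kappa>"
    using assms(2,4,3)
  proof (induction K rule: finite_ne_induct)
    case (singleton x)
    then show ?case using Cinfinite_refl[OF assms(1)] by auto
  next
    case (insert x F)
    then obtain k where k: "k \<in> F" "\<forall>i\<in>F. (i, k) \<in> \<kappa>" by auto
    show ?case
    proof (cases "(x, k) \<in> \<kappa>")
      case True
      then show ?thesis using k by blast
    next
      case False
      then have "(k, x) \<in> \<kappa>"
        using underS_cases[OF assms(1), of x k] insert k by (auto simp: underS_def)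
      moreover have "(x, x) \<in> \<kappa>" using Cinfinite_refl[OF assms(1)] insert by auto
      ultimately show ?thesis
        using k Cinfinite_trans[OF assms(1)] by blast
    qed
  qed
  then show ?thesis using that by blast
qed

lemma not_cofinal_imp_bounded:
  assumes "Cinfinite \<kappa>" "K \<subseteq> Field \<kappa>" "\<not> cofinal K \<kappa>"
  obtains k where "k \<in> Field \<kappa>" "K \<subseteq> underS \<kappa> k"
proof -
  obtain a where a: "a \<in> Field \<kappa>" "\<And>b. b \<in> K \<Longrightarrow> a = b \<or> (a, b) \<notin> \<kappa>"
    using assms(3) by (auto simp: cofinal_def)
  obtain k where k: "k \<in> Field \<kappa>" "a \<in> underS \<kappa> k"
    using Cinfinite_underS_greater[OF assms(1) a(1)] .
  have "K \<subseteq> underS \<kappa> k"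
  proof
    fix b assume b: "b \<in> K"
    then have "(b, a) \<in> \<kappa>"
      using a underS_cases[OF assms(1), of b a] assms(2) Cinfinite_refl[OF assms(1)]
      by (auto simp: underS_def)
    then show "b \<in> underS \<kappa> k" using trans_underS_eq[OF assms(1) _ k(2)] by blast
  qed
  then show ?thesis using k that by blast
qed

lemma regularCard_bounded:
  assumes "Cinfinite \<kappa>" "regularCard \<kappa>" "K \<subseteq> Field \<kappa>" "|K| <o \<kappa>"
  obtains k where "k \<in> Field \<kappa>" "K \<subseteq> underS \<kappa> k"
  using not_cofinal_imp_bounded[OF assms(1,3)] assms(2-4) not_ordLess_ordIso
  unfolding regularCard_def by blast

lemma Cinfinite_least:
  assumes "Cinfinite \<kappa>" "S \<subseteq> Field \<kappa>" "S \<noteq> {}"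
  obtains m where "m \<in> S" "\<And>s. s \<in> S \<Longrightarrow> (m, s) \<in> \<kappa>"
proof -
  obtain s where "s \<in> S" using assms(3) by blast
  then obtain m where m: "m \<in> S" "\<And>y. (y, m) \<in> \<kappa> - Id \<Longrightarrow> y \<notin> S"
    using wfE_min[OF wf_minus_Id[OF assms(1)]] by metis
  have "(m, s) \<in> \<kappa>" if "s \<in> S" for s
    using underS_cases[OF assms(1), of s m] m that assms(2) by (auto simp: underS_def)
  then show ?thesis using that m(1) by blast
qed

lemma Cinfinite_Field_ne: "Cinfinite \<kappa> \<Longrightarrow> Field \<kappa> \<noteq> {}"
  by (auto simp: cinfinite_def)

lemma Cinfinite_card_of: "infinite A \<Longrightarrow> Cinfinite |A|"
  by (simp add: cinfinite_def Field_card_of card_of_card_order_on)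

lemma card_underS_less: "Cinfinite \<kappa> \<Longrightarrow> i \<in> Field \<kappa> \<Longrightarrow> |underS \<kappa> i| <o \<kappa>"
  by (simp add: card_of_underS)

lemma card_Field_ordLeq: "Cinfinite \<kappa> \<Longrightarrow> |Field \<kappa>| \<le>o \<kappa>"
  by (simp add: card_of_Field_ordIso ordIso_imp_ordLeq)

lemma finite_ordLess_Cinfinite: "Cinfinite \<kappa> \<Longrightarrow> finite A \<Longrightarrow> |A| <o \<kappa>"
  by (intro Cfinite_ordLess_Cinfinite) (auto simp: cfinite_def card_of_card_order_on Field_card_of)

lemma card_of_image_ordLeq: "|A| \<le>o \<kappa> \<Longrightarrow> |f ` A| \<le>o \<kappa>"
  using card_of_image ordLeq_transitive by blast

lemma card_of_image_ordLess: "|A| <o \<kappa> \<Longrightarrow> |f ` A| <o \<kappa>"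
  using card_of_image ordLeq_ordLess_trans by blast

lemma card_of_subset_ordLess: "A \<subseteq> B \<Longrightarrow> |B| <o \<kappa> \<Longrightarrow> |A| <o \<kappa>"
  using card_of_mono1 ordLeq_ordLess_trans by blast

lemma card_of_subset_ordLeq: "A \<subseteq> B \<Longrightarrow> |B| \<le>o \<kappa> \<Longrightarrow> |A| \<le>o \<kappa>"
  using card_of_mono1 ordLeq_transitive by blast

lemma inj_into_Field:
  assumes "Card_order \<kappa>" "|A| \<le>o \<kappa>"
  obtains g where "inj_on g A" "g ` A \<subseteq> Field \<kappa>"
proof -
  have "|A| \<le>o |Field \<kappa>|"
    using assms card_of_Field_ordIso ordIso_symmetric ordLeq_ordIso_trans by blast
  then show ?thesis using that by (auto simp: card_of_ordLeq[symmetric])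
qed

lemma inj_from_Field:
  assumes "Card_order \<kappa>" "\<kappa> \<le>o |A|"
  obtains g where "inj_on g (Field \<kappa>)" "g ` Field \<kappa> \<subseteq> A"
proof -
  have "|Field \<kappa>| \<le>o |A|"
    using assms card_of_Field_ordIso ordIso_ordLeq_trans by blast
  then show ?thesis using that by (auto simp: card_of_ordLeq[symmetric])
qed

lemma card_of_Fpow_ordLeq:
  assumes "infinite A"
  shows "|Fpow A| \<le>o |A|"
proof -
  define T where "T n = {S. S \<subseteq> A \<and> finite S \<and> card S = n}" for n
  have T: "|T n| \<le>o |A|" for n
  proof (induction n)
    case 0
    have "T 0 \<subseteq> {{}}" by (auto simp: T_def)
    then show ?case
      using assms card_of_subset_ordLeq[OF _ card_of_singl_ordLeq] by (metis finite.emptyI)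
  next
    case (Suc n)
    have "T (Suc n) \<subseteq> (\<lambda>(a, S). insert a S) ` (A \<times> T n)"
    proof
      fix S assume "S \<in> T (Suc n)"
      then obtain a S' where "S = insert a S'" "a \<notin> S'" "card S' = n" "S \<subseteq> A" "finite S"
        by (auto simp: T_def card_Suc_eq)
      then show "S \<in> (\<lambda>(a, S). insert a S) ` (A \<times> T n)"
        by (intro image_eqI[of _ _ "(a, S')"]) (auto simp: T_def)
    qed
    moreover have "|A \<times> T n| \<le>o |A|"
      using card_of_Sigma_ordLeq_infinite[OF assms card_of_refl[THEN ordIso_imp_ordLeq], of "\<lambda>_. T n"]
        Suc by auto
    ultimately show ?case using card_of_subset_ordLeq card_of_image_ordLeq by blast
  qed
  have "Fpow A = (\<Union>n. T n)" by (auto simp: T_def Fpow_def)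
  moreover have "|\<Union>n. T n| \<le>o |A|"
    using assms T infinite_iff_card_of_nat by (intro card_of_UNION_ordLeq_infinite) auto
  ultimately show ?thesis by simp
qed

lemma card_of_Fpow_ordLess:
  assumes "Cinfinite \<kappa>" "|A| <o \<kappa>"
  shows "|Fpow A| <o \<kappa>"
proof (cases "finite A")
  case True
  then show ?thesis
    using finite_ordLess_Cinfinite[OF assms(1)] finite_subset[OF Fpow_subset_Pow]
      finite_Pow_iff by metis
next
  case False
  then show ?thesis using card_of_Fpow_ordLeq assms(2) ordLeq_ordLess_trans by blast
qed

lemma card_of_Fpow_ordLeq_Cinfinite:
  assumes "Cinfinite \<kappa>" "|A| \<le>o \<kappa>"
  shows "|Fpow A| \<le>o \<kappa>"
proof (cases "finite A")
  case True
  then show ?thesis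
    using card_of_Fpow_ordLess[OF assms(1)] finite_ordLess_Cinfinite[OF assms(1)] ordLess_imp_ordLeq
    by blast
next
  case False
  then show ?thesis using card_of_Fpow_ordLeq assms(2) ordLeq_transitive by blast
qed

section \<open>Small subsets of a set of regular size\<close>

text \<open>
  The cardinal arithmetic \<open>2\<^bsup><\<kappa>\<^esup> \<le> \<kappa>\<close>. Only this consequence of GCH enters the topology.
\<close>

definition pow_below :: "'k rel \<Rightarrow> bool" where
  "pow_below \<kappa> \<longleftrightarrow> (\<forall>S \<subseteq> Field \<kappa>. |S| <o \<kappa> \<longrightarrow> |Pow S| \<le>o \<kappa>)"

text \<open>
  If \<open>|S| < \<kappa> < |Pow S|\<close>, then \<open>\<kappa>\<close> is a forbidden intermediate cardinal. The injection carries \<open>\<kappa>\<close>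
  to the type at which GCH is assumed.
\<close>

lemma GCH_pow_below:
  fixes \<kappa> :: "'k rel" and f :: "'k \<Rightarrow> 'b"
  assumes "GCH TYPE('b)" "Cinfinite \<kappa>" "inj f"
  shows "pow_below \<kappa>"
  unfolding pow_below_def
proof (intro allI impI)
  fix S assume S: "S \<subseteq> Field \<kappa>" "|S| <o \<kappa>"
  show "|Pow S| \<le>o \<kappa>"
  proof (cases "finite S")
    case True
    then show ?thesis
      using finite_ordLess_Cinfinite[OF assms(2)] ordLess_imp_ordLeq finite_Pow_iff by blast
  next
    case False
    define A where "A = f ` S"
    define C where "C = (\<lambda>x. {f x}) ` Field \<kappa>"
    have inj: "inj_on f T" for T using assms(3) inj_on_subset by blast
    have SA: "|S| =o |A|"
      unfolding A_def using inj card_of_ordIsoI[of f S] by (simp add: inj_on_imp_bij_betw)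
    have "bij_betw (\<lambda>x. {f x}) (Field \<kappa>) C"
      unfolding C_def by (rule inj_on_imp_bij_betw) (use assms(3) in \<open>auto simp: inj_on_def\<close>)
    then have C: "|C| =o \<kappa>"
      using card_of_ordIsoI card_of_Field_ordIso assms(2) ordIso_symmetric ordIso_transitive
      by metis
    have "|A| <o |C|"
      using SA C S(2) ordIso_symmetric ordIso_ordLess_trans ordLess_ordIso_trans by metis
    moreover have "infinite A" unfolding A_def using False inj finite_imageD by blast
    ultimately have "\<not> |C| <o |Pow A|" using assms(1) by (auto simp: GCH_def)
    then have "|Pow A| \<le>o |C|"
      by (simp add: card_of_Well_order not_ordLess_iff_ordLeq)
    moreover have "|Pow S| \<le>o |Pow A|"
    proof -
      have "inj_on ((`) f) (Pow S)"
        using assms(3) by (simp add: inj_on_def inj_image_eq_iff)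
      then show ?thesis by (rule card_of_ordLeqI) (auto simp: A_def)
    qed
    ultimately show ?thesis using C ordLeq_transitive ordLeq_ordIso_trans by blast
  qed
qed

text \<open>
  This is \<open>\<kappa>\<^bsup><\<kappa>\<^esup> \<le> \<kappa>\<close>: by regularity a subset of \<open>\<kappa>\<close> of size less than \<open>\<kappa>\<close> is bounded, so it belongs
  to one of the \<open>\<kappa>\<close> many power sets of initial segments.
\<close>

lemma card_of_small_subsets:
  assumes "Cinfinite \<kappa>" "regularCard \<kappa>" "pow_below \<kappa>" "|A| \<le>o \<kappa>"
  shows "|{S. S \<subseteq> A \<and> |S| <o \<kappa>}| \<le>o \<kappa>"
proof -
  obtain g where g: "inj_on g A" "g ` A \<subseteq> Field \<kappa>"
    using inj_into_Field assms by blast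
  have "|{S. S \<subseteq> A \<and> |S| <o \<kappa>}| \<le>o |\<Union>k\<in>Field \<kappa>. Pow (underS \<kappa> k)|"
  proof (rule card_of_ordLeqI)
    show "inj_on ((`) g) {S. S \<subseteq> A \<and> |S| <o \<kappa>}"
      using g(1) by (auto simp: inj_on_def dest: inj_on_image_eq_iff[THEN iffD1, rotated -1])
    fix S assume S: "S \<in> {S. S \<subseteq> A \<and> |S| <o \<kappa>}"
    then obtain k where "k \<in> Field \<kappa>" "g ` S \<subseteq> underS \<kappa> k"
      using regularCard_bounded[OF assms(1,2), of "g ` S"] g(2) card_of_image_ordLess by blast
    then show "g ` S \<in> (\<Union>k\<in>Field \<kappa>. Pow (underS \<kappa> k))" by blast
  qed
  moreover have "|\<Union>k\<in>Field \<kappa>. Pow (underS \<kappa> k)| \<le>o \<kappa>"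
  proof (rule UNION_Cinfinite_bound[OF _ _ assms(1)])
    show "|Field \<kappa>| \<le>o \<kappa>" by (rule card_Field_ordLeq[OF assms(1)])
    show "\<forall>k\<in>Field \<kappa>. |Pow (underS \<kappa> k)| \<le>o \<kappa>"
      using assms(1,3) by (simp add: card_underS_less underS_Field_subset pow_below_def)
  qed
  ultimately show ?thesis using ordLeq_transitive by blast
qed

lemma card_of_Pow_small:
  assumes "Cinfinite \<kappa>" "regularCard \<kappa>" "pow_below \<kappa>" "|A| <o \<kappa>"
  shows "|Pow A| \<le>o \<kappa>"
proof -
  have "Pow A \<subseteq> {S. S \<subseteq> A \<and> |S| <o \<kappa>}" using assms(4) card_of_subset_ordLess by auto
  then show ?thesis
    using card_of_subset_ordLeq card_of_small_subsets[OF assms(1-3) ordLess_imp_ordLeq[OF assms(4)]]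
    by blast
qed

text \<open>
  The union of \<open>\<kappa>\<close> many stages is closed under \<open>\<phi>\<close> because, by regularity, a small subset of the union
  is already contained in the union of the stages below some index. A stage adds at most \<open>\<kappa>\<close> points since
  \<open>\<kappa>\<^bsup><\<kappa>\<^esup> \<le> \<kappa>\<close>.
\<close>

lemma closing_off:
  fixes \<kappa> :: "'k rel" and \<phi> :: "'a set \<Rightarrow> 'a set"
  assumes \<kappa>: "Cinfinite \<kappa>" "regularCard \<kappa>" "pow_below \<kappa>"
    and \<phi>: "\<And>S. |S| <o \<kappa> \<Longrightarrow> |\<phi> S| \<le>o \<kappa>"
  obtains A where "|A| \<le>o \<kappa>" "\<And>S. S \<subseteq> A \<Longrightarrow> |S| <o \<kappa> \<Longrightarrow> \<phi> S \<subseteq> A"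
proof -
  define step where "step B = \<Union> (\<phi> ` {S. S \<subseteq> B \<and> |S| <o \<kappa>}) \<union> B" for B
  obtain A where A: "\<And>i. A i = step (\<Union>j\<in>underS \<kappa> i. A j)"
  proof -
    have "\<exists>A. \<forall>i. A i = step (\<Union>j\<in>underS \<kappa> i. A j)"
    proof (rule dependent_wf_choice[OF wf_minus_Id[OF \<kappa>(1)], of "\<lambda>A i r. r = step (\<Union>j\<in>underS \<kappa> i. A j)"])
      fix f g :: "'k \<Rightarrow> 'a set" and x r
      assume "\<And>z. (z, x) \<in> \<kappa> - Id \<Longrightarrow> f z = g z"
      then have "(\<Union>j\<in>underS \<kappa> x. f j) = (\<Union>j\<in>underS \<kappa> x. g j)"
        by (auto simp: underS_def)
      then show "(r = step (\<Union>j\<in>underS \<kappa> x. f j)) = (r = step (\<Union>j\<in>underS \<kappa> x. g j))" by simp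
    qed auto
    then show ?thesis using that by blast
  qed
  have step: "|step B| \<le>o \<kappa>" if "|B| \<le>o \<kappa>" for B
    unfolding step_def using that card_of_small_subsets[OF \<kappa> that] \<phi>
    by (intro Un_Cinfinite_bound UNION_Cinfinite_bound \<kappa>) auto
  have card: "|A i| \<le>o \<kappa>" for i
  proof (induction i rule: wf_induct_rule[OF wf_minus_Id[OF \<kappa>(1)]])
    case (1 i)
    have "|underS \<kappa> i| \<le>o \<kappa>"
      by (rule card_of_subset_ordLeq[OF underS_Field_subset card_Field_ordLeq[OF \<kappa>(1)]])
    then have "|\<Union>j\<in>underS \<kappa> i. A j| \<le>o \<kappa>"
      using 1 by (intro UNION_Cinfinite_bound \<kappa>) (auto simp: underS_def)
    then show ?case using step A[of i] by simp
  qed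
  show ?thesis
  proof (rule that[of "\<Union>i\<in>Field \<kappa>. A i"])
    show "|\<Union>i\<in>Field \<kappa>. A i| \<le>o \<kappa>"
      using card card_Field_ordLeq[OF \<kappa>(1)] by (intro UNION_Cinfinite_bound \<kappa>) auto
    fix S assume S: "S \<subseteq> (\<Union>i\<in>Field \<kappa>. A i)" "|S| <o \<kappa>"
    then have "\<forall>s\<in>S. \<exists>i\<in>Field \<kappa>. s \<in> A i" by auto
    then obtain i where i: "\<And>s. s \<in> S \<Longrightarrow> i s \<in> Field \<kappa> \<and> s \<in> A (i s)" by metis
    obtain k where k: "k \<in> Field \<kappa>" "i ` S \<subseteq> underS \<kappa> k"
      using regularCard_bounded[OF \<kappa>(1,2), of "i ` S"] i S(2) card_of_image_ordLess by blast
    then have "S \<subseteq> (\<Union>j\<in>underS \<kappa> k. A j)" using i by blast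
    then have "\<phi> S \<subseteq> A k" using A[of k] S(2) by (auto simp: step_def)
    then show "\<phi> S \<subseteq> (\<Union>i\<in>Field \<kappa>. A i)" using k(1) by blast
  qed
qed

section \<open>Neighbourhoods, compactness and escape sequences\<close>

lemma nbhds_iff: "U \<in> nbhds X p \<longleftrightarrow> U \<subseteq> topspace X \<and> (\<exists>W. openin X W \<and> p \<in> W \<and> W \<subseteq> U)"
  by (auto simp: nbhds_def interior_of_def)

lemma nbhds_complement:
  assumes "p \<in> topspace X"
  shows "topspace X - S \<in> nbhds X p \<longleftrightarrow> p \<notin> X closure_of S"
  using assms by (simp add: nbhds_def interior_of_complement)

lemma nbhds_mono: "U \<in> nbhds X p \<Longrightarrow> U \<subseteq> V \<Longrightarrow> V \<subseteq> topspace X \<Longrightarrow> V \<in> nbhds X p"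
  by (auto simp: nbhds_def dest: interior_of_mono)

lemma nbhds_Int: "U \<in> nbhds X p \<Longrightarrow> V \<in> nbhds X p \<Longrightarrow> U \<inter> V \<in> nbhds X p"
  by (auto simp: nbhds_def interior_of_Int)

lemma open_in_nbhds: "openin X W \<Longrightarrow> p \<in> W \<Longrightarrow> W \<in> nbhds X p"
  using openin_subset by (fastforce simp: nbhds_iff)

lemma nbhds_Inter:
  assumes "finite B" "B \<subseteq> nbhds X p" "p \<in> topspace X"
  shows "topspace X \<inter> \<Inter>B \<in> nbhds X p"
  using assms
proof (induction B rule: finite_induct)
  case empty
  then show ?case by (simp add: open_in_nbhds)
next
  case (insert U B)
  then show ?case using nbhds_Int[of U X p "topspace X \<inter> \<Inter>B"] by (simp add: Int_left_commute)
qed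

lemma compact_fip_indexed:
  assumes "compact_space X" "\<And>i. i \<in> I \<Longrightarrow> closedin X (N i)"
    and "\<And>J. finite J \<Longrightarrow> J \<subseteq> I \<Longrightarrow> topspace X \<inter> \<Inter> (N ` J) \<noteq> {}"
  shows "topspace X \<inter> \<Inter> (N ` I) \<noteq> {}"
proof -
  have "\<Inter>\<F> \<noteq> {}" if F: "finite \<F>" "\<F> \<subseteq> insert (topspace X) (N ` I)" for \<F>
  proof -
    obtain J where J: "finite J" "J \<subseteq> I" "\<F> - {topspace X} = N ` J"
      using F finite_subset_image[of "\<F> - {topspace X}" N I] by (metis Diff_subset_conv finite_Diff insert_is_Un)
    have "\<Inter>\<F> \<supseteq> topspace X \<inter> \<Inter> (N ` J)" unfolding J(3)[symmetric] by blast
    then show ?thesis using assms(3)[OF J(1,2)] by blast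
  qed
  moreover have "closedin X C" if "C \<in> insert (topspace X) (N ` I)" for C
    using assms(2) that by auto
  ultimately have "\<Inter> (insert (topspace X) (N ` I)) \<noteq> {}"
    using assms(1)[unfolded compact_space_fip, rule_format, of "insert (topspace X) (N ` I)"] by simp
  then show ?thesis by simp
qed

lemma compactum_closed_nbhd:
  assumes "compactum X" "openin X W" "z \<in> W"
  obtains V N where "openin X V" "closedin X N" "z \<in> V" "V \<subseteq> N" "N \<subseteq> W"
proof -
  have "neighbourhood_base_of (closedin X) X"
    using assms(1) compact_Hausdorff_imp_regular_space
    by (auto simp: compactum_def neighbourhood_base_of_closedin)
  then show ?thesis using assms(2,3) that unfolding neighbourhood_base_of by blast
qed

text \<open>
  Open and closed neighbourhoods are interleaved, each contained in the one before. With
  closed sets of this kind, the intersection of fewer than \<open>\<kappa>\<close> of them is again an intersection of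
  fewer than \<open>\<kappa>\<close> open sets when \<open>\<kappa>\<close> is uncountable and regular; transfinite recursions on \<open>\<kappa>\<close>
  depend on this at limit stages.
\<close>

lemma closed_G_delta:
  assumes X: "compactum X" and W: "openin X W" "z \<in> W"
  obtains \<O> where "countable \<O>" "\<And>U. U \<in> \<O> \<Longrightarrow> openin X U" "z \<in> \<Inter>\<O>" "\<Inter>\<O> \<subseteq> W"
    "closedin X (topspace X \<inter> \<Inter>\<O>)"
proof -
  obtain f where f0: "f 0 = W" and f: "\<And>n. openin X (f n) \<and> z \<in> f n"
    and fN: "\<And>n. \<exists>N. closedin X N \<and> f (Suc n) \<subseteq> N \<and> N \<subseteq> f n"
  proof -
    have "\<exists>f. \<forall>n. ((openin X (f n) \<and> z \<in> f n) \<and> (n = 0 \<longrightarrow> f n = W)) \<and>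
      (\<exists>N. closedin X N \<and> f (Suc n) \<subseteq> N \<and> N \<subseteq> f n)"
    proof (rule dependent_nat_choice)
      fix U and n :: nat assume "(openin X U \<and> z \<in> U) \<and> (n = 0 \<longrightarrow> U = W)"
      then obtain V N where "openin X V" "closedin X N" "z \<in> V" "V \<subseteq> N" "N \<subseteq> U"
        using compactum_closed_nbhd[OF X] by metis
      then show "\<exists>V. ((openin X V \<and> z \<in> V) \<and> (Suc n = 0 \<longrightarrow> V = W)) \<and>
          (\<exists>N. closedin X N \<and> V \<subseteq> N \<and> N \<subseteq> U)"
        by auto
    qed (use W in auto)
    then show ?thesis using that by metis
  qed
  obtain N where N: "\<And>n. closedin X (N n)" "\<And>n. f (Suc n) \<subseteq> N n" "\<And>n. N n \<subseteq> f n"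
    using fN by metis
  have "topspace X \<inter> \<Inter>(range f) = \<Inter>(range N)"
  proof
    show "topspace X \<inter> \<Inter>(range f) \<subseteq> \<Inter>(range N)" using N(2) by blast
    have "N n \<subseteq> topspace X" for n using N(1) closedin_subset by blast
    then show "\<Inter>(range N) \<subseteq> topspace X \<inter> \<Inter>(range f)" using N(3) by blast
  qed
  moreover have "closedin X (\<Inter>(range N))" using N(1) by (intro closedin_Inter) auto
  ultimately have "closedin X (topspace X \<inter> \<Inter>(range f))" by simp
  then show ?thesis using that[of "range f"] f f0 by auto
qed

text \<open>
  Removing longer and longer initial segments of an enumeration without repetitions gives properly
  decreasing sets, whether \<open>\<kappa>\<close> is regular or singular.
\<close>

lemma escape_seq_of_enumeration:
  assumes \<kappa>: "Cinfinite \<kappa>" and a: "inj_on a (Field \<kappa>)" "a ` Field \<kappa> \<subseteq> topspace X"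
    and q: "q \<in> X closure_of (a ` Field \<kappa>)"
      "\<And>i. i \<in> Field \<kappa> \<Longrightarrow> q \<notin> X closure_of (a ` underS \<kappa> i)"
  shows "escape_seq X q \<kappa> (\<lambda>i. topspace X - a ` underS \<kappa> i)"
proof -
  have qX: "q \<in> topspace X" using q(1) by (meson in_closure_of)
  have "(\<Union>i\<in>Field \<kappa>. underS \<kappa> i) = Field \<kappa>"
  proof
    show "(\<Union>i\<in>Field \<kappa>. underS \<kappa> i) \<subseteq> Field \<kappa>" by (simp add: UN_least underS_Field_subset)
    show "Field \<kappa> \<subseteq> (\<Union>i\<in>Field \<kappa>. underS \<kappa> i)"
      using Cinfinite_underS_greater[OF \<kappa>] by (metis UN_I subsetI)
  qed
  then have eq: "(\<Union>i\<in>Field \<kappa>. a ` underS \<kappa> i) = a ` Field \<kappa>" by blast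
  have "Field \<kappa> \<noteq> {}" using \<kappa> by (auto simp: cinfinite_def)
  then have "(\<Inter>i\<in>Field \<kappa>. topspace X - a ` underS \<kappa> i) = topspace X - a ` Field \<kappa>"
    unfolding eq[symmetric] by blast
  moreover have "topspace X - a ` underS \<kappa> j \<subset> topspace X - a ` underS \<kappa> i"
    if "(i, j) \<in> \<kappa>" "i \<noteq> j" for i j
  proof -
    have ij: "i \<in> underS \<kappa> j" "i \<in> Field \<kappa>" using that by (auto simp: underS_def Field_def)
    have "underS \<kappa> i \<subseteq> underS \<kappa> j" using underS_trans_eq[OF \<kappa> _ that(1)] by blast
    moreover have "a i \<notin> a ` underS \<kappa> i"
      using a(1) ij(2) underS_Field_subset[of \<kappa> i]
      by (simp add: inj_on_image_mem_iff) (simp add: underS_def)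
    ultimately show ?thesis using ij a(2) by blast
  qed
  ultimately show ?thesis
    using q(1) q(2) qX by (simp add: escape_seq_def nbhds_complement)
qed

text \<open>
  Arhangel'skii's free sequences of length \<open>\<kappa>\<close>.
\<close>

definition free_seq :: "'a topology \<Rightarrow> 'k rel \<Rightarrow> ('k \<Rightarrow> 'a) \<Rightarrow> bool" where
  "free_seq X \<kappa> x \<longleftrightarrow> x ` Field \<kappa> \<subseteq> topspace X \<and>
     (\<forall>i\<in>Field \<kappa>. X closure_of (x ` underS \<kappa> i) \<inter> X closure_of (x ` above \<kappa> i) = {})"

text \<open>
  By compactness the closures of the final segments have a common point \<open>q\<close>. Freeness keeps \<open>q\<close> out
  of the closure of every initial segment, so the enumeration \<open>x\<close> itself provides an escape
  sequence at \<open>q\<close>.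
\<close>

lemma free_seq_escape:
  assumes X: "compact_space X" and \<kappa>: "Cinfinite \<kappa>" and x: "free_seq X \<kappa> x"
  obtains q U where "q \<in> topspace X" "escape_seq X q \<kappa> U"
proof -
  have xX: "x ` Field \<kappa> \<subseteq> topspace X" using x by (simp add: free_seq_def)
  have above: "above \<kappa> i \<subseteq> Field \<kappa>" for i by (auto simp: above_def Field_def)
  have ne: "Field \<kappa> \<noteq> {}" using \<kappa> by (auto simp: cinfinite_def)
  have "topspace X \<inter> (\<Inter>i\<in>Field \<kappa>. X closure_of (x ` above \<kappa> i)) \<noteq> {}"
  proof (rule compact_fip_indexed[OF X])
    fix J assume J: "finite J" "J \<subseteq> Field \<kappa>"
    show "topspace X \<inter> (\<Inter>i\<in>J. X closure_of (x ` above \<kappa> i)) \<noteq> {}"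
    proof (cases "J = {}")
      case False
      obtain k where k: "k \<in> J" "\<And>i. i \<in> J \<Longrightarrow> (i, k) \<in> \<kappa>"
        using finite_subset_has_max[OF \<kappa> J False] by blast
      have "x k \<in> X closure_of (x ` above \<kappa> i)" if "i \<in> J" for i
      proof -
        have "x k \<in> x ` above \<kappa> i" using k(2)[OF that] by (auto simp: above_def)
        moreover have "x ` above \<kappa> i \<subseteq> topspace X" using above xX by blast
        ultimately show ?thesis using closure_of_subset by blast
      qed
      then show ?thesis using k(1) J(2) xX by blast
    qed (use xX ne in auto)
  qed simp
  then obtain q where q: "q \<in> topspace X"
    "\<And>i. i \<in> Field \<kappa> \<Longrightarrow> q \<in> X closure_of (x ` above \<kappa> i)" by auto
  have sep: "x i \<noteq> x j" if "j \<in> Field \<kappa>" "i \<in> underS \<kappa> j" for i j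
  proof -
    have "x i \<in> X closure_of (x ` underS \<kappa> j)"
      using that(2) xX underS_Field_subset[of \<kappa> j] closure_of_subset[of "x ` underS \<kappa> j" X] by blast
    moreover have "x j \<in> X closure_of (x ` above \<kappa> j)"
      using xX above[of j] closure_of_subset[of "x ` above \<kappa> j" X] Cinfinite_refl[OF \<kappa> that(1)]
      by (auto simp: above_def)
    ultimately show ?thesis using x that(1) unfolding free_seq_def by (metis IntI emptyE)
  qed
  have "inj_on x (Field \<kappa>)"
  proof (rule inj_onI, rule ccontr)
    fix i j assume ij: "i \<in> Field \<kappa>" "j \<in> Field \<kappa>" "x i = x j" "i \<noteq> j"
    then have "i \<in> underS \<kappa> j \<or> j \<in> underS \<kappa> i"
      using underS_cases[OF \<kappa> ij(1,2)] by (auto simp: underS_def)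
    then show False using sep ij by metis
  qed
  moreover obtain k where "k \<in> Field \<kappa>" using ne by blast
  then have "q \<in> X closure_of (x ` Field \<kappa>)"
    by (rule subsetD[OF closure_of_mono[OF image_mono[OF above]] q(2)])
  moreover have "q \<notin> X closure_of (x ` underS \<kappa> i)" if "i \<in> Field \<kappa>" for i
    using q(2)[OF that] x that unfolding free_seq_def by blast
  ultimately show ?thesis
    using that q(1) escape_seq_of_enumeration[OF \<kappa> _ xX] by blast
qed

section \<open>Transport along homeomorphisms\<close>

lemma homeomorphic_map_nbhds:
  assumes h: "homeomorphic_map X X h" and U: "U \<subseteq> topspace X" and q: "q \<in> topspace X"
  shows "h ` U \<in> nbhds X (h q) \<longleftrightarrow> U \<in> nbhds X q"
proof -
  have inj: "inj_on h (topspace X)" and im: "h ` topspace X = topspace X"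
    using homeomorphic_imp_injective_map[OF h] homeomorphic_imp_surjective_map[OF h] by auto
  have "X interior_of (h ` U) = h ` (X interior_of U)"
    using homeomorphic_map_interior_of[OF h U] .
  moreover have "h q \<in> h ` (X interior_of U) \<longleftrightarrow> q \<in> X interior_of U"
    using inj q interior_of_subset_topspace[of X U] by (metis inj_on_image_mem_iff)
  ultimately show ?thesis using U im by (auto simp: nbhds_def)
qed

lemma homeomorphic_map_Inter:
  assumes h: "homeomorphic_map X X h" and O: "\<O> \<subseteq> Pow (topspace X)"
  shows "topspace X \<inter> \<Inter>((`) h ` \<O>) = h ` (topspace X \<inter> \<Inter>\<O>)"
proof -
  have inj: "inj_on h (topspace X)" and im: "h ` topspace X = topspace X"
    using homeomorphic_imp_injective_map[OF h] homeomorphic_imp_surjective_map[OF h] by auto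
  show ?thesis
  proof
    show "topspace X \<inter> \<Inter>((`) h ` \<O>) \<subseteq> h ` (topspace X \<inter> \<Inter>\<O>)"
    proof
      fix y assume y: "y \<in> topspace X \<inter> \<Inter>((`) h ` \<O>)"
      then obtain z where z: "z \<in> topspace X" "y = h z" using im by blast
      have "z \<in> U" if "U \<in> \<O>" for U
        using y z that O inj inj_on_image_mem_iff[of h "topspace X" z U] by auto
      then show "y \<in> h ` (topspace X \<inter> \<Inter>\<O>)" using z by blast
    qed
  qed (use im in auto)
qed

lemma homeomorphic_map_escape_seq:
  assumes h: "homeomorphic_map X X h" and q: "q \<in> topspace X" and \<kappa>: "Cinfinite \<kappa>"
    and U: "escape_seq X q \<kappa> U"
  shows "escape_seq X (h q) \<kappa> (\<lambda>i. h ` U i)"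
proof -
  have inj: "inj_on h (topspace X)" and im: "h ` topspace X = topspace X"
    using homeomorphic_imp_injective_map[OF h] homeomorphic_imp_surjective_map[OF h] by auto
  have UX: "U i \<subseteq> topspace X" if "i \<in> Field \<kappa>" for i
    using U that by (auto simp: escape_seq_def nbhds_def)
  obtain k where k: "k \<in> Field \<kappa>" using \<kappa> by (metis cinfinite_def ex_in_conv finite.emptyI)
  have "(\<Inter>i\<in>Field \<kappa>. h ` U i) = topspace X \<inter> \<Inter>((`) h ` U ` Field \<kappa>)"
    using UX im k by blast
  also have "\<dots> = h ` (topspace X \<inter> \<Inter>(U ` Field \<kappa>))"
    by (rule homeomorphic_map_Inter[OF h]) (use UX in auto)
  also have "topspace X \<inter> \<Inter>(U ` Field \<kappa>) = \<Inter>(U ` Field \<kappa>)"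
    using UX k by blast
  finally have I: "(\<Inter>i\<in>Field \<kappa>. h ` U i) = h ` \<Inter>(U ` Field \<kappa>)" .
  have "h ` \<Inter>(U ` Field \<kappa>) \<notin> nbhds X (h q)"
    using homeomorphic_map_nbhds[OF h _ q] UX k U unfolding escape_seq_def
    by (metis INF_lower2)
  moreover have "h ` U j \<subset> h ` U i" if "(i, j) \<in> \<kappa>" "i \<noteq> j" for i j
  proof -
    have "U j \<subset> U i" using U that by (auto simp: escape_seq_def)
    moreover have "U i \<subseteq> topspace X" using UX that by (auto simp: Field_def)
    ultimately show ?thesis using inj
      by (metis image_strict_mono inj_on_subset)
  qed
  ultimately show ?thesis
    using U homeomorphic_map_nbhds[OF h UX q] by (simp add: escape_seq_def I)
qed

lemma homogeneous_escape_seq: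
  assumes "homogeneous X" "Cinfinite \<kappa>" "q \<in> topspace X" "escape_seq X q \<kappa> U" "p \<in> topspace X"
  obtains V where "escape_seq X p \<kappa> V"
  using assms homeomorphic_map_escape_seq unfolding homogeneous_def by metis

text \<open>
  Such a family represents the intersection of its members, a \<open>G\<^bsub><\<kappa>\<^esub>\<close> set. The family is kept rather
  than the intersection because its members are counted and used in open covers.
\<close>

definition small_G :: "'a topology \<Rightarrow> 'k rel \<Rightarrow> 'a set set \<Rightarrow> bool" where
  "small_G X \<kappa> \<O> \<longleftrightarrow> |\<O>| <o \<kappa> \<and> (\<forall>U\<in>\<O>. openin X U)"

lemma homeomorphic_map_small_G:
  assumes h: "homeomorphic_map X X h" and O: "small_G X \<kappa> \<O>"
  shows "small_G X \<kappa> ((`) h ` \<O>)" "topspace X \<inter> \<Inter>((`) h ` \<O>) = h ` (topspace X \<inter> \<Inter>\<O>)"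
proof -
  have sub: "U \<subseteq> topspace X" if "U \<in> \<O>" for U
    using O that openin_subset by (auto simp: small_G_def)
  show "small_G X \<kappa> ((`) h ` \<O>)"
    using O card_of_image_ordLess sub homeomorphic_map_openness[OF h] by (auto simp: small_G_def)
  show "topspace X \<inter> \<Inter>((`) h ` \<O>) = h ` (topspace X \<inter> \<Inter>\<O>)"
    using homeomorphic_map_Inter[OF h, of \<O>] sub by blast
qed

section \<open>Free sequences from transfinite recursion\<close>

lemma small_G_UNION:
  assumes "Cinfinite \<kappa>" "regularCard \<kappa>" "|I| <o \<kappa>" "\<And>i. i \<in> I \<Longrightarrow> small_G X \<kappa> (\<O> i)"
  shows "small_G X \<kappa> (\<Union>i\<in>I. \<O> i)"
  using assms card_of_UNION_ordLess_infinite_Field_regularCard[OF assms(2,1,3), of \<O>]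
  by (auto simp: small_G_def)

lemma countable_imp_small_G:
  assumes "natLeq <o \<kappa>" "countable \<O>" "\<And>U. U \<in> \<O> \<Longrightarrow> openin X U"
  shows "small_G X \<kappa> \<O>"
proof -
  obtain f :: "_ \<Rightarrow> nat" where "inj_on f \<O>" using assms(2) by (auto simp: countable_def)
  then have "|\<O>| \<le>o |UNIV :: nat set|" by (rule card_of_ordLeqI) simp
  then have "|\<O>| <o \<kappa>"
    using card_of_nat assms(1) ordLeq_ordIso_trans ordLeq_ordLess_trans by blast
  then show ?thesis using assms(3) by (simp add: small_G_def)
qed

text \<open>
  A recursion common to two constructions. At stage \<open>i\<close> the intersection of the earlier closed \<open>G\<^sub>\<delta>\<close>
  sets is nonempty by compactness and is a \<open>G\<^bsub><\<kappa>\<^esub>\<close> set. By hypothesis it is not contained in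
  the forbidden set \<open>C x i\<close>, which depends on the earlier points only. A point of
  it outside \<open>C x i\<close> is chosen as \<open>x i\<close>, together with a closed \<open>G\<^sub>\<delta>\<close> set around that point which
  avoids \<open>C x i\<close>.
\<close>

lemma descending_closed_sets:
  fixes X :: "'a topology" and \<kappa> :: "'k rel" and C :: "('k \<Rightarrow> 'a) \<Rightarrow> 'k \<Rightarrow> 'a set"
  assumes X: "compactum X" "topspace X \<noteq> {}"
    and \<kappa>: "Cinfinite \<kappa>" "regularCard \<kappa>" "natLeq <o \<kappa>"
    and closed: "\<And>x i. i \<in> Field \<kappa> \<Longrightarrow> closedin X (C x i)"
    and local: "\<And>x y i. (\<And>j. j \<in> underS \<kappa> i \<Longrightarrow> x j = y j) \<Longrightarrow> C x i = C y i"
    and avoid: "\<And>x i \<O>. i \<in> Field \<kappa> \<Longrightarrow> x ` underS \<kappa> i \<subseteq> topspace X \<Longrightarrow> small_G X \<kappa> \<O> \<Longrightarrow>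
      topspace X \<inter> \<Inter>\<O> \<noteq> {} \<Longrightarrow> \<not> topspace X \<inter> \<Inter>\<O> \<subseteq> C x i"
  obtains x N where "x ` Field \<kappa> \<subseteq> topspace X" "\<And>i. i \<in> Field \<kappa> \<Longrightarrow> closedin X (N i)"
    "\<And>i. i \<in> Field \<kappa> \<Longrightarrow> N i \<inter> C x i = {}" "\<And>i j. (i, j) \<in> \<kappa> \<Longrightarrow> x j \<in> N i"
proof -
  define M where "M \<O> = topspace X \<inter> \<Inter>\<O>" for \<O> :: "'a set set"
  \<comment> \<open>Stage \<open>i\<close> chooses a pair \<open>r\<close>: the point \<open>x i\<close> and a countable family of open sets whose
    intersection in \<open>X\<close> is \<open>N i\<close>.\<close>
  define P where "P f i r \<longleftrightarrow> (i \<in> Field \<kappa> \<longrightarrow> countable (snd r) \<and> (\<forall>U\<in>snd r. openin X U) \<and>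
      closedin X (M (snd r)) \<and> M (snd r) \<inter> C (fst \<circ> f) i = {} \<and> fst r \<in> M (snd r) \<and>
      (\<forall>j\<in>underS \<kappa> i. fst r \<in> M (snd (f j))))" for f :: "'k \<Rightarrow> 'a \<times> 'a set set" and i r
  have "\<exists>f. \<forall>i. P f i (f i)"
  proof (rule dependent_wf_choice[OF wf_minus_Id[OF \<kappa>(1)]])
    fix f g :: "'k \<Rightarrow> 'a \<times> 'a set set" and i r
    assume "\<And>z. (z, i) \<in> \<kappa> - Id \<Longrightarrow> f z = g z"
    then have eq: "f j = g j" if "j \<in> underS \<kappa> i" for j using that by (auto simp: underS_def)
    then have "C (fst \<circ> f) i = C (fst \<circ> g) i" by (intro local) simp
    then show "P f i r = P g i r" using eq by (simp add: P_def)
  next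
    fix i and f :: "'k \<Rightarrow> 'a \<times> 'a set set"
    assume "\<And>j. (j, i) \<in> \<kappa> - Id \<Longrightarrow> P f j (f j)"
    then have IH: "P f j (f j)" "j \<in> Field \<kappa>" if "j \<in> underS \<kappa> i" for j
      using that underS_Field_subset[of \<kappa> i] by (auto simp: underS_def)
    show "\<exists>r. P f i r"
    proof (cases "i \<in> Field \<kappa>")
      case i: True
      define \<O> where "\<O> = (\<Union>j\<in>underS \<kappa> i. snd (f j))"
      have small: "small_G X \<kappa> \<O>"
        unfolding \<O>_def
      proof (rule small_G_UNION[OF \<kappa>(1,2) card_underS_less[OF \<kappa>(1) i]])
        show "small_G X \<kappa> (snd (f j))" if "j \<in> underS \<kappa> i" for j
          using IH[OF that] countable_imp_small_G[OF \<kappa>(3)] by (auto simp: P_def)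
      qed
      have "topspace X \<inter> (\<Inter>j\<in>underS \<kappa> i. M (snd (f j))) \<noteq> {}"
      proof (rule compact_fip_indexed)
        show "compact_space X" using X by (simp add: compactum_def)
        show "closedin X (M (snd (f j)))" if "j \<in> underS \<kappa> i" for j
          using IH[OF that] by (simp add: P_def)
        fix J assume J: "finite J" "J \<subseteq> underS \<kappa> i"
        show "topspace X \<inter> (\<Inter>j\<in>J. M (snd (f j))) \<noteq> {}"
        proof (cases "J = {}")
          case False
          have "J \<subseteq> Field \<kappa>" using J(2) underS_Field_subset[of \<kappa> i] by simp
          then obtain k where k: "k \<in> J" "\<And>j. j \<in> J \<Longrightarrow> (j, k) \<in> \<kappa>"
            using finite_subset_has_max[OF \<kappa>(1) J(1) _ False] by metis
          have "P f k (f k)" "k \<in> Field \<kappa>" using IH k(1) J(2) by auto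
          then have "fst (f k) \<in> M (snd (f j))" if "j \<in> J" for j
            using k(2)[OF that] by (cases "j = k") (auto simp: P_def underS_def)
          then have "fst (f k) \<in> topspace X \<inter> (\<Inter>j\<in>J. M (snd (f j)))"
            using k(1) by (auto simp: M_def)
          then show ?thesis by blast
        qed (use X(2) in simp)
      qed
      moreover have "topspace X \<inter> (\<Inter>j\<in>underS \<kappa> i. M (snd (f j))) = topspace X \<inter> \<Inter>\<O>"
        by (auto simp: M_def \<O>_def)
      moreover have "(fst \<circ> f) ` underS \<kappa> i \<subseteq> topspace X"
        using IH by (auto simp: P_def M_def)
      ultimately obtain z where z: "z \<in> topspace X \<inter> \<Inter>\<O>" "z \<notin> C (fst \<circ> f) i"
        using avoid[OF i, of "fst \<circ> f" \<O>] small by auto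
      have "openin X (topspace X - C (fst \<circ> f) i)" using closed[OF i] by blast
      then obtain \<U> where \<U>: "countable \<U>" "\<And>U. U \<in> \<U> \<Longrightarrow> openin X U" "z \<in> \<Inter>\<U>"
        "\<Inter>\<U> \<subseteq> topspace X - C (fst \<circ> f) i" "closedin X (topspace X \<inter> \<Inter>\<U>)"
        using closed_G_delta[OF X(1), of "topspace X - C (fst \<circ> f) i" z] z by blast
      have "P f i (z, \<U>)" using \<U> z by (auto simp: P_def M_def \<O>_def)
      then show ?thesis by blast
    qed (simp add: P_def)
  qed
  then obtain f where f: "\<And>i. P f i (f i)" by blast
  show ?thesis
  proof (rule that[of "fst \<circ> f" "\<lambda>i. M (snd (f i))"])
    fix i j assume ij: "(i, j) \<in> \<kappa>"
    then have "j \<in> Field \<kappa>" by (auto simp: Field_def)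
    then show "(fst \<circ> f) j \<in> M (snd (f i))"
      using f[of j] ij by (cases "i = j") (auto simp: P_def underS_def)
  next
    fix i assume i: "i \<in> Field \<kappa>"
    show "closedin X (M (snd (f i)))" "M (snd (f i)) \<inter> C (fst \<circ> f) i = {}"
      using f[of i] i by (auto simp: P_def)
  next
    show "(fst \<circ> f) ` Field \<kappa> \<subseteq> topspace X"
    proof
      fix y assume "y \<in> (fst \<circ> f) ` Field \<kappa>"
      then obtain i where "i \<in> Field \<kappa>" "y = fst (f i)" by auto
      then show "y \<in> topspace X" using f[of i] by (simp add: P_def M_def)
    qed
  qed
qed

text \<open>
  Arhangel'skii's argument: otherwise the closure of the earlier points can be forbidden at every stage
  of the recursion, and the points chosen form a free sequence.
\<close>

lemma small_G_in_closure:
  fixes X :: "'a topology" and \<kappa> :: "'k rel"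
  assumes X: "compactum X" "topspace X \<noteq> {}"
    and \<kappa>: "Cinfinite \<kappa>" "regularCard \<kappa>" "natLeq <o \<kappa>"
    and no_free: "\<And>x. \<not> free_seq X \<kappa> x"
  obtains \<O> B where "small_G X \<kappa> \<O>" "topspace X \<inter> \<Inter>\<O> \<noteq> {}" "B \<subseteq> topspace X" "|B| <o \<kappa>"
    "topspace X \<inter> \<Inter>\<O> \<subseteq> X closure_of B"
proof (rule ccontr)
  assume contra: "\<not> thesis"
  have "\<exists>x N. x ` Field \<kappa> \<subseteq> topspace X \<and> (\<forall>i\<in>Field \<kappa>. closedin X (N i)) \<and>
    (\<forall>i\<in>Field \<kappa>. N i \<inter> X closure_of (x ` underS \<kappa> i) = {}) \<and> (\<forall>i j. (i, j) \<in> \<kappa> \<longrightarrow> x j \<in> N i)"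
  proof (rule descending_closed_sets[OF X \<kappa>, of "\<lambda>x i. X closure_of (x ` underS \<kappa> i)"])
    fix x y :: "'k \<Rightarrow> 'a" and i
    assume "\<And>j. j \<in> underS \<kappa> i \<Longrightarrow> x j = y j"
    then have "x ` underS \<kappa> i = y ` underS \<kappa> i" by (intro image_cong) auto
    then show "X closure_of (x ` underS \<kappa> i) = X closure_of (y ` underS \<kappa> i)" by simp
  next
    fix x :: "'k \<Rightarrow> 'a" and i \<O>
    assume "i \<in> Field \<kappa>" "x ` underS \<kappa> i \<subseteq> topspace X" "small_G X \<kappa> \<O>" "topspace X \<inter> \<Inter>\<O> \<noteq> {}"
    then show "\<not> topspace X \<inter> \<Inter>\<O> \<subseteq> X closure_of (x ` underS \<kappa> i)"
      using contra that[of \<O> "x ` underS \<kappa> i"] card_of_image_ordLess card_underS_less[OF \<kappa>(1)]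
      by metis
  next
    fix x :: "'k \<Rightarrow> 'a" and N
    assume "x ` Field \<kappa> \<subseteq> topspace X" "\<And>i. i \<in> Field \<kappa> \<Longrightarrow> closedin X (N i)"
      "\<And>i. i \<in> Field \<kappa> \<Longrightarrow> N i \<inter> X closure_of (x ` underS \<kappa> i) = {}"
      "\<And>i j. (i, j) \<in> \<kappa> \<Longrightarrow> x j \<in> N i"
    then show ?thesis by blast
  qed simp
  then obtain x N where x: "x ` Field \<kappa> \<subseteq> topspace X" "\<And>i. i \<in> Field \<kappa> \<Longrightarrow> closedin X (N i)"
      "\<And>i. i \<in> Field \<kappa> \<Longrightarrow> N i \<inter> X closure_of (x ` underS \<kappa> i) = {}"
      "\<And>i j. (i, j) \<in> \<kappa> \<Longrightarrow> x j \<in> N i"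
    by blast
  have "X closure_of (x ` above \<kappa> i) \<subseteq> N i" if "i \<in> Field \<kappa>" for i
    using x(2)[OF that] x(4) by (intro closure_of_minimal) (auto simp: above_def)
  then have "free_seq X \<kappa> x" unfolding free_seq_def using x(1,3) by blast
  then show False using no_free by blast
qed

text \<open>
  A diagonal form of the Cech--Pospisil theorem. If no point is a \<open>G\<^bsub><\<kappa>\<^esub>\<close> set, then the
  \<open>i\<close>-th point of the space can be forbidden at stage \<open>i\<close> of the recursion. If the stages enumerate
  all points, the closed sets obtained have no common point, against compactness.
\<close>

lemma small_compactum_has_small_G_point:
  fixes X :: "'a topology" and \<kappa> :: "'k rel"
  assumes X: "compactum X" "topspace X \<noteq> {}"
    and \<kappa>: "Cinfinite \<kappa>" "regularCard \<kappa>" "natLeq <o \<kappa>"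
    and card: "|topspace X| \<le>o \<kappa>"
  obtains q \<O> where "q \<in> topspace X" "small_G X \<kappa> \<O>" "topspace X \<inter> \<Inter>\<O> = {q}"
proof (rule ccontr)
  assume contra: "\<not> thesis"
  obtain g where g: "inj_on g (topspace X)" "g ` topspace X \<subseteq> Field \<kappa>"
    using inj_into_Field[OF _ card] \<kappa>(1) by blast
  define C where "C i = {z \<in> topspace X. g z = i}" for i
  have C: "C i = {} \<or> (\<exists>z\<in>topspace X. C i = {z})" for i
  proof (cases "\<exists>z\<in>topspace X. g z = i")
    case True
    then obtain z where z: "z \<in> topspace X" "g z = i" by blast
    then have "C i = {z}" using g(1) by (auto simp: C_def dest: inj_onD)
    then show ?thesis using z(1) by blast
  qed (auto simp: C_def)
  have "\<exists>(x :: 'k \<Rightarrow> 'a) N. x ` Field \<kappa> \<subseteq> topspace X \<and> (\<forall>i\<in>Field \<kappa>. closedin X (N i)) \<and>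
    (\<forall>i\<in>Field \<kappa>. N i \<inter> C i = {}) \<and> (\<forall>i j. (i, j) \<in> \<kappa> \<longrightarrow> x j \<in> N i)"
  proof (rule descending_closed_sets[OF X \<kappa>, of "\<lambda>_. C"])
    fix i
    have "C i \<subseteq> topspace X" "finite (C i)" using C[of i] by auto
    then show "closedin X (C i)"
      using X(1) Hausdorff_imp_t1_space t1_space_closedin_finite by (auto simp: compactum_def)
  next
    fix i \<O>
    assume "small_G X \<kappa> \<O>" "topspace X \<inter> \<Inter>\<O> \<noteq> {}"
    then show "\<not> topspace X \<inter> \<Inter>\<O> \<subseteq> C i"
      using contra that[of _ \<O>] C[of i] by (metis subset_empty subset_singletonD)
  next
    fix x :: "'k \<Rightarrow> 'a" and N
    assume "x ` Field \<kappa> \<subseteq> topspace X" "\<And>i. i \<in> Field \<kappa> \<Longrightarrow> closedin X (N i)"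
      "\<And>i. i \<in> Field \<kappa> \<Longrightarrow> N i \<inter> C i = {}" "\<And>i j. (i, j) \<in> \<kappa> \<Longrightarrow> x j \<in> N i"
    then show ?thesis by blast
  qed simp
  then obtain x :: "'k \<Rightarrow> 'a" and N where x: "x ` Field \<kappa> \<subseteq> topspace X"
      "\<And>i. i \<in> Field \<kappa> \<Longrightarrow> closedin X (N i)" "\<And>i. i \<in> Field \<kappa> \<Longrightarrow> N i \<inter> C i = {}"
      "\<And>i j. (i, j) \<in> \<kappa> \<Longrightarrow> x j \<in> N i"
    by blast
  have "topspace X \<inter> (\<Inter>i\<in>Field \<kappa>. N i) \<noteq> {}"
  proof (rule compact_fip_indexed)
    show "compact_space X" using X by (simp add: compactum_def)
    fix J assume J: "finite J" "J \<subseteq> Field \<kappa>"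
    show "topspace X \<inter> (\<Inter>j\<in>J. N j) \<noteq> {}"
    proof (cases "J = {}")
      case False
      obtain k where k: "k \<in> J" "\<And>j. j \<in> J \<Longrightarrow> (j, k) \<in> \<kappa>"
        using finite_subset_has_max[OF \<kappa>(1) J False] by metis
      then have "x k \<in> topspace X \<inter> (\<Inter>j\<in>J. N j)" using x(1,4) J(2) by blast
      then show ?thesis by blast
    qed (use X(2) in simp)
  qed (use x(2) in simp)
  then obtain z where z: "z \<in> topspace X" "\<And>i. i \<in> Field \<kappa> \<Longrightarrow> z \<in> N i" by blast
  have "g z \<in> Field \<kappa>" using g(2) z(1) by blast
  then show False using x(3) z by (auto simp: C_def)
qed

text \<open>
  In a compactum, pseudocharacter and character agree: choose a closed neighbourhood of \<open>q\<close> inside each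
  member of the family. Their finite intersections form a base at \<open>q\<close> by compactness.
\<close>

lemma small_G_point_character:
  fixes X :: "'a topology"
  assumes X: "compactum X" and \<kappa>: "Cinfinite \<kappa>"
    and O: "small_G X \<kappa> \<O>" "topspace X \<inter> \<Inter>\<O> = {q}"
  obtains B where "cofinal_nbhds X q B" "|B| <o \<kappa>"
proof -
  \<comment> \<open>If \<open>X = {q}\<close>, the family \<open>\<O>\<close> may be empty; the whole space as an additional member lets the
    compactness argument below cover this case.\<close>
  define \<O>' where "\<O>' = {topspace X} \<union> \<O>"
  have op: "openin X U \<and> q \<in> U" if "U \<in> \<O>'" for U
    using O that by (auto simp: small_G_def \<O>'_def)
  have card: "|\<O>'| <o \<kappa>" unfolding \<O>'_def
    using O(1) finite_ordLess_Cinfinite[OF \<kappa>] by (intro Un_Cinfinite_bound_strict \<kappa>) (auto simp: small_G_def)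
  have "\<forall>U\<in>\<O>'. \<exists>N. closedin X N \<and> N \<in> nbhds X q \<and> N \<subseteq> U"
  proof
    fix U assume "U \<in> \<O>'"
    then obtain V N where "openin X V" "closedin X N" "q \<in> V" "V \<subseteq> N" "N \<subseteq> U"
      using compactum_closed_nbhd[OF X] op by metis
    then show "\<exists>N. closedin X N \<and> N \<in> nbhds X q \<and> N \<subseteq> U"
      using closedin_subset unfolding nbhds_iff by metis
  qed
  then obtain N where N: "\<And>U. U \<in> \<O>' \<Longrightarrow> closedin X (N U) \<and> N U \<in> nbhds X q \<and> N U \<subseteq> U"
    by metis
  define B where "B = (\<lambda>F. topspace X \<inter> \<Inter>(N ` F)) ` Fpow \<O>'"
  have qX: "q \<in> topspace X" using O(2) by blast
  show ?thesis
  proof (rule that[of B])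
    show "|B| <o \<kappa>"
      unfolding B_def using card_of_image_ordLess card_of_Fpow_ordLess[OF \<kappa> card] by blast
    show "cofinal_nbhds X q B"
      unfolding cofinal_nbhds_def
    proof (intro conjI ballI)
      show "B \<subseteq> nbhds X q"
      proof
        fix S assume "S \<in> B"
        then obtain F where F: "S = topspace X \<inter> \<Inter>(N ` F)" "finite F" "F \<subseteq> \<O>'"
          by (auto simp: B_def Fpow_def)
        then show "S \<in> nbhds X q" using N nbhds_Inter[OF _ _ qX, of "N ` F"] by auto
      qed
      fix U assume "U \<in> nbhds X q"
      then obtain W where W: "openin X W" "q \<in> W" "W \<subseteq> U" by (auto simp: nbhds_iff)
      have "\<exists>F. finite F \<and> F \<subseteq> \<O>' \<and> topspace X \<inter> \<Inter>(N ` F) \<subseteq> W"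
      proof (rule ccontr)
        assume neg: "\<not> ?thesis"
        have "topspace X \<inter> (\<Inter>U\<in>\<O>'. N U - W) \<noteq> {}"
        proof (rule compact_fip_indexed)
          show "compact_space X" using X by (simp add: compactum_def)
          show "closedin X (N U - W)" if "U \<in> \<O>'" for U
            using N[OF that] W(1) by (simp add: closedin_diff)
          fix J assume J: "finite J" "J \<subseteq> \<O>'"
          then have "\<not> topspace X \<inter> \<Inter>(N ` J) \<subseteq> W" using neg by blast
          then show "topspace X \<inter> (\<Inter>U\<in>J. N U - W) \<noteq> {}" by blast
        qed
        then obtain z where z: "z \<in> topspace X" "\<And>U. U \<in> \<O>' \<Longrightarrow> z \<in> N U - W" by blast
        have "z \<in> topspace X \<inter> \<Inter>\<O>" using z N by (auto simp: \<O>'_def)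
        then have "z = q" using O(2) by blast
        moreover have "z \<notin> W" using z(2)[of "topspace X"] by (auto simp: \<O>'_def)
        ultimately show False using W(2) by blast
      qed
      then show "\<exists>V\<in>B. V \<subseteq> U" using W(3) unfolding B_def Fpow_def by blast
    qed
  qed
qed

text \<open>
  Shapirovskii's theorem that the \<open>\<pi>\<close>-character is bounded by the lengths of free sequences. If \<open>p\<close>
  has no small local \<open>\<pi>\<close>-base, closed neighbourhoods \<open>N j\<close> and \<open>M j\<close> of \<open>p\<close> with \<open>N j\<close> inside the
  interior of \<open>M j\<close> are chosen recursively. The aim is that for each \<open>i\<close> some point \<open>x i\<close> lies in
  all \<open>N j\<close> with \<open>j \<le> i\<close> and outside the interior of all \<open>M j\<close> with \<open>j > i\<close>; then the \<open>x i\<close> form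
  a free sequence. By compactness it is enough to meet finitely many of these conditions at a
  time, and this is kept possible by choosing \<open>M i\<close> so small that it contains none of the
  fewer than \<open>\<kappa>\<close> many open sets arising from the finite conditions below \<open>i\<close>.
\<close>

lemma small_local_pi_base:
  fixes X :: "'a topology" and \<kappa> :: "'k rel"
  assumes X: "compactum X" "p \<in> topspace X"
    and \<kappa>: "Cinfinite \<kappa>" "regularCard \<kappa>"
    and no_free: "\<And>x. \<not> free_seq X \<kappa> x"
  obtains \<V> where "|\<V>| <o \<kappa>" "\<And>V. V \<in> \<V> \<Longrightarrow> openin X V \<and> V \<noteq> {}"
    "\<And>W. openin X W \<Longrightarrow> p \<in> W \<Longrightarrow> \<exists>V\<in>\<V>. V \<subseteq> W"
proof (rule ccontr)
  assume contra: "\<not> thesis"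
  define G where "G f F E = topspace X \<inter> (\<Inter>j\<in>F. X interior_of fst (f j)) \<inter>
      (\<Inter>j\<in>E. topspace X - snd (f j))" for f :: "'k \<Rightarrow> 'a set \<times> 'a set" and F E
  \<comment> \<open>A finite condition: be close to \<open>p\<close> at the indices in \<open>F\<close> and away from \<open>p\<close> at those in \<open>E\<close>, all
    of which come later. Without this order the two demands could contradict each other.
    The pair \<open>f j\<close> is \<open>(N j, M j)\<close>, and \<open>G f F E\<close> is the open set given by the condition.\<close>
  define lt where "lt F E \<longleftrightarrow> (\<forall>a\<in>F. \<forall>b\<in>E. a \<in> underS \<kappa> b)" for F E
  define P where "P f i r \<longleftrightarrow> (i \<in> Field \<kappa> \<longrightarrow> closedin X (fst r) \<and> closedin X (snd r) \<and>
      p \<in> X interior_of fst r \<and> fst r \<subseteq> X interior_of snd r \<and>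
      (\<forall>F E. finite F \<and> finite E \<and> F \<subseteq> underS \<kappa> i \<and> E \<subseteq> underS \<kappa> i \<and> lt F E \<longrightarrow>
        \<not> G f F E \<subseteq> snd r))" for f i r
  have G_cong: "G f F E = G g F E" if "\<And>j. j \<in> F \<union> E \<Longrightarrow> f j = g j" for f g F E
    using that by (simp add: G_def)
  have ne: "G f F E \<noteq> {}" if fin: "finite F" "finite E" and sub: "F \<subseteq> Field \<kappa>" "E \<subseteq> Field \<kappa>"
    and "lt F E" and f: "\<And>j. j \<in> F \<union> E \<Longrightarrow> P f j (f j)" for f F E
  proof (cases "E = {}")
    case True
    have "p \<in> X interior_of fst (f j)" if "j \<in> F" for j
      using f[of j] that sub by (auto simp: P_def)
    then have "p \<in> G f F E" using X(2) True by (simp add: G_def)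
    then show ?thesis by blast
  next
    case False
    \<comment> \<open>All other indices are below the last index \<open>m\<close> of \<open>E\<close>, so \<open>M m\<close> was chosen not to contain the
      open set given by them.\<close>
    obtain m where m: "m \<in> E" "\<And>i. i \<in> E \<Longrightarrow> (i, m) \<in> \<kappa>"
      using finite_subset_has_max[OF \<kappa>(1) fin(2) sub(2) False] by blast
    have "F \<subseteq> underS \<kappa> m" using \<open>lt F E\<close> m(1) by (auto simp: lt_def)
    moreover have "E - {m} \<subseteq> underS \<kappa> m" using m(2) by (auto simp: underS_def)
    moreover have "lt F (E - {m})" using \<open>lt F E\<close> by (auto simp: lt_def)
    ultimately have "\<not> G f F (E - {m}) \<subseteq> snd (f m)"
      using f[of m] m(1) sub(2) fin unfolding P_def by blast
    then obtain z where "z \<in> G f F (E - {m})" "z \<notin> snd (f m)" by blast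
    then have "z \<in> G f F E" unfolding G_def by blast
    then show ?thesis by blast
  qed
  have "\<exists>f. \<forall>i. P f i (f i)"
  proof (rule dependent_wf_choice[OF wf_minus_Id[OF \<kappa>(1)]])
    fix f g :: "'k \<Rightarrow> 'a set \<times> 'a set" and i r
    assume "\<And>z. (z, i) \<in> \<kappa> - Id \<Longrightarrow> f z = g z"
    then have eq: "f j = g j" if "j \<in> underS \<kappa> i" for j using that by (auto simp: underS_def)
    have "G f F E = G g F E" if FE: "F \<subseteq> underS \<kappa> i" "E \<subseteq> underS \<kappa> i" for F E
    proof (rule G_cong)
      show "f j = g j" if "j \<in> F \<union> E" for j using eq FE that by auto
    qed
    then show "P f i r = P g i r" unfolding P_def by (intro imp_cong refl conj_cong all_cong) auto
  next
    fix i and f :: "'k \<Rightarrow> 'a set \<times> 'a set"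
    assume "\<And>j. (j, i) \<in> \<kappa> - Id \<Longrightarrow> P f j (f j)"
    then have IH: "P f j (f j)" "j \<in> Field \<kappa>" if "j \<in> underS \<kappa> i" for j
      using that underS_Field_subset[of \<kappa> i] by (auto simp: underS_def)
    show "\<exists>r. P f i r"
    proof (cases "i \<in> Field \<kappa>")
      case i: True
      define \<G> where "\<G> = (\<Union>F\<in>Fpow (underS \<kappa> i). G f F ` {E \<in> Fpow (underS \<kappa> i). lt F E})"
      have "|\<G>| <o \<kappa>"
        unfolding \<G>_def
      proof (rule card_of_UNION_ordLess_infinite_Field_regularCard[OF \<kappa>(2,1)])
        show *: "|Fpow (underS \<kappa> i)| <o \<kappa>"
          using card_of_Fpow_ordLess[OF \<kappa>(1) card_underS_less[OF \<kappa>(1) i]] .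
        show "\<forall>F\<in>Fpow (underS \<kappa> i). |G f F ` {E \<in> Fpow (underS \<kappa> i). lt F E}| <o \<kappa>"
          by (intro ballI card_of_image_ordLess card_of_subset_ordLess[OF _ *]) auto
      qed
      moreover have "openin X V \<and> V \<noteq> {}" if V: "V \<in> \<G>" for V
      proof -
        obtain F E where FE: "V = G f F E" "finite F" "finite E" "F \<subseteq> underS \<kappa> i"
            "E \<subseteq> underS \<kappa> i" "lt F E"
          using V by (auto simp: \<G>_def Fpow_def)
        have "F \<subseteq> Field \<kappa>" "E \<subseteq> Field \<kappa>" using FE(4,5) underS_Field_subset[of \<kappa> i] by auto
        then have "V \<noteq> {}" unfolding FE(1) using FE IH by (intro ne) auto
        moreover have "openin X ((\<Inter>j\<in>F. X interior_of fst (f j)) \<inter> topspace X)"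
          using FE(2) by (intro openin_INT) auto
        moreover have "openin X ((\<Inter>j\<in>E. topspace X - snd (f j)) \<inter> topspace X)"
          using FE(3,5) IH by (intro openin_INT) (auto simp: P_def)
        moreover have "V = ((\<Inter>j\<in>F. X interior_of fst (f j)) \<inter> topspace X) \<inter>
            ((\<Inter>j\<in>E. topspace X - snd (f j)) \<inter> topspace X)"
          unfolding FE(1) G_def by blast
        ultimately show ?thesis by (simp add: openin_Int)
      qed
      ultimately have "\<exists>W. openin X W \<and> p \<in> W \<and> (\<forall>V\<in>\<G>. \<not> V \<subseteq> W)"
        using contra that[of \<G>] by metis
      then obtain W where W: "openin X W" "p \<in> W" "\<And>V. V \<in> \<G> \<Longrightarrow> \<not> V \<subseteq> W"
        by blast
      obtain V M where VM: "openin X V" "closedin X M" "p \<in> V" "V \<subseteq> M" "M \<subseteq> W"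
        using compactum_closed_nbhd[OF X(1) W(1,2)] .
      obtain U N where UN: "openin X U" "closedin X N" "p \<in> U" "U \<subseteq> N" "N \<subseteq> V"
        using compactum_closed_nbhd[OF X(1) VM(1,3)] .
      have "N \<subseteq> X interior_of M" "p \<in> X interior_of N"
        using UN VM interior_of_maximal[of U N X] interior_of_maximal[of V M X] by auto
      moreover have "\<not> G f F E \<subseteq> M"
        if "finite F" "finite E" "F \<subseteq> underS \<kappa> i" "E \<subseteq> underS \<kappa> i" "lt F E" for F E
      proof -
        have "G f F E \<in> \<G>" using that by (auto simp: \<G>_def Fpow_def)
        then show ?thesis using W(3) VM(5) by blast
      qed
      ultimately have "P f i (N, M)" using UN VM by (auto simp: P_def)
      then show ?thesis by blast
    qed (simp add: P_def)
  qed
  then obtain f where f: "\<And>i. P f i (f i)" by blast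
  define K where "K i j = (if (j, i) \<in> \<kappa> then fst (f j) else topspace X - X interior_of snd (f j))"
    for i j
  have "\<exists>z. z \<in> topspace X \<inter> (\<Inter>j\<in>Field \<kappa>. K i j)" if i: "i \<in> Field \<kappa>" for i
  proof -
    have "topspace X \<inter> (\<Inter>j\<in>Field \<kappa>. K i j) \<noteq> {}"
    proof (rule compact_fip_indexed)
      show "compact_space X" using X by (simp add: compactum_def)
      show "closedin X (K i j)" if "j \<in> Field \<kappa>" for j
        using f[of j] that closedin_diff[OF closedin_topspace openin_interior_of[of X "snd (f j)"]]
        by (simp add: K_def P_def)
      fix J assume J: "finite J" "J \<subseteq> Field \<kappa>"
      \<comment> \<open>The indices up to \<open>i\<close> precede the others, as \<open>lt\<close> demands.\<close>
      define F where "F = {j \<in> J. (j, i) \<in> \<kappa>}"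
      define E where "E = J - F"
      have "lt F E"
        unfolding lt_def
      proof (intro ballI)
        fix a b assume "a \<in> F" "b \<in> E"
        then have "(a, i) \<in> \<kappa>" "i \<in> underS \<kappa> b"
          using underS_cases[OF \<kappa>(1) i, of b] J(2) by (auto simp: F_def E_def)
        then show "a \<in> underS \<kappa> b" using trans_underS_eq[OF \<kappa>(1)] by blast
      qed
      then have "G f F E \<noteq> {}" using J f by (intro ne) (auto simp: F_def E_def)
      moreover have "G f F E \<subseteq> topspace X \<inter> (\<Inter>j\<in>J. K i j)"
      proof
        fix z assume z: "z \<in> G f F E"
        have "z \<in> K i j" if j: "j \<in> J" for j
        proof (cases "j \<in> F")
          case True
          then have "z \<in> X interior_of fst (f j)" using z unfolding G_def by blast
          then show ?thesis
            using True interior_of_subset[of X "fst (f j)"] by (auto simp: K_def F_def)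
        next
          case False
          then have "z \<in> topspace X - snd (f j)" using z j unfolding G_def E_def by blast
          then show ?thesis
            using False j interior_of_subset[of X "snd (f j)"] by (auto simp: K_def F_def)
        qed
        then show "z \<in> topspace X \<inter> (\<Inter>j\<in>J. K i j)" using z by (auto simp: G_def)
      qed
      ultimately show "topspace X \<inter> (\<Inter>j\<in>J. K i j) \<noteq> {}" by blast
    qed
    then show ?thesis by blast
  qed
  then obtain x where x: "\<And>i. i \<in> Field \<kappa> \<Longrightarrow> x i \<in> topspace X \<inter> (\<Inter>j\<in>Field \<kappa>. K i j)"
    by metis
  have "X closure_of (x ` underS \<kappa> i) \<inter> X closure_of (x ` above \<kappa> i) = {}"
    if i: "i \<in> Field \<kappa>" for i
  proof -
    have Pi: "closedin X (fst (f i))" "fst (f i) \<subseteq> X interior_of snd (f i)"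
      using f[of i] i by (auto simp: P_def)
    have "x j \<in> topspace X - X interior_of snd (f i)" if "j \<in> underS \<kappa> i" for j
    proof -
      have "j \<in> Field \<kappa>" using that underS_Field_subset[of \<kappa> i] by blast
      moreover have "(i, j) \<notin> \<kappa>" using that Cinfinite_antisym[OF \<kappa>(1)] by (auto simp: underS_def)
      ultimately show ?thesis using x[of j] i by (auto simp: K_def)
    qed
    then have 1: "X closure_of (x ` underS \<kappa> i) \<subseteq> topspace X - X interior_of snd (f i)"
      by (intro closure_of_minimal) auto
    have "x j \<in> fst (f i)" if "j \<in> above \<kappa> i" for j
    proof -
      have "j \<in> Field \<kappa>" "(i, j) \<in> \<kappa>" using that by (auto simp: above_def Field_def)
      then show ?thesis using x[of j] i by (auto simp: K_def)
    qed
    then have "X closure_of (x ` above \<kappa> i) \<subseteq> fst (f i)"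
      using Pi by (intro closure_of_minimal) auto
    then show ?thesis using 1 Pi(2) by blast
  qed
  then have "free_seq X \<kappa> x" using x by (auto simp: free_seq_def)
  then show False using no_free by blast
qed

section \<open>The cardinality of a homogeneous compactum\<close>

text \<open>
  A point \<open>q\<close> of the closure of \<open>S\<close> is coded by the traces on \<open>S\<close> of open neighbourhoods of \<open>q\<close>
  whose closures lie in the members of \<open>\<O> q\<close>. There are at most \<open>\<kappa>\<close> codes, and two points with the same
  code lie in the same \<open>G\<^bsub><\<kappa>\<^esub>\<close> set, so one point for each code suffices.
\<close>

lemma closure_covered_by_few_small_G:
  fixes X :: "'a topology" and \<kappa> :: "'k rel"
  assumes X: "compactum X" and \<kappa>: "Cinfinite \<kappa>" "regularCard \<kappa>" "pow_below \<kappa>"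
    and O: "\<And>q. q \<in> topspace X \<Longrightarrow> small_G X \<kappa> (\<O> q) \<and> q \<in> \<Inter>(\<O> q)"
    and S: "|S| <o \<kappa>"
  obtains Q where "Q \<subseteq> topspace X" "|Q| \<le>o \<kappa>" "X closure_of S \<subseteq> (\<Union>q\<in>Q. \<Inter>(\<O> q))"
proof -
  have "\<exists>W N. openin X W \<and> closedin X N \<and> q \<in> W \<and> W \<subseteq> N \<and> N \<subseteq> U"
    if "q \<in> topspace X" "U \<in> \<O> q" for q U
  proof -
    have "openin X U" "q \<in> U" using O that by (auto simp: small_G_def)
    then show ?thesis using compactum_closed_nbhd[OF X] by metis
  qed
  then obtain W N where WN: "\<And>q U. q \<in> topspace X \<Longrightarrow> U \<in> \<O> q \<Longrightarrow>
      openin X (W q U) \<and> closedin X (N q U) \<and> q \<in> W q U \<and> W q U \<subseteq> N q U \<and> N q U \<subseteq> U"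
    by metis
  define c where "c q = (\<lambda>U. W q U \<inter> S) ` \<O> q" for q
  have clX: "X closure_of S \<subseteq> topspace X" by (rule closure_of_subset_topspace)
  define Q where "Q = inv_into (X closure_of S) c ` c ` (X closure_of S)"
  have Q: "Q \<subseteq> X closure_of S" unfolding Q_def by (auto intro: inv_into_into)
  have "c ` (X closure_of S) \<subseteq> {d. d \<subseteq> Pow S \<and> |d| <o \<kappa>}"
    using O clX card_of_image_ordLess by (fastforce simp: c_def small_G_def)
  then have "|c ` (X closure_of S)| \<le>o \<kappa>"
    by (rule card_of_subset_ordLeq[OF _ card_of_small_subsets[OF \<kappa> card_of_Pow_small[OF \<kappa> S]]])
  then have "|Q| \<le>o \<kappa>" unfolding Q_def by (rule card_of_image_ordLeq)
  moreover have "X closure_of S \<subseteq> (\<Union>q\<in>Q. \<Inter>(\<O> q))"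
  proof
    fix r assume r: "r \<in> X closure_of S"
    define q where "q = inv_into (X closure_of S) c (c r)"
    have q: "q \<in> Q" "q \<in> X closure_of S" "c q = c r"
      using r by (auto simp: q_def Q_def inv_into_into f_inv_into_f)
    have "r \<in> U" if U: "U \<in> \<O> q" for U
    proof -
      have "W q U \<inter> S \<in> c r" using U unfolding q(3)[symmetric] by (auto simp: c_def)
      then obtain U' where U': "U' \<in> \<O> r" "W q U \<inter> S = W r U' \<inter> S" by (auto simp: c_def)
      have WNr: "openin X (W r U')" "r \<in> W r U'" using WN[of r U'] U' r clX by auto
      have WNq: "closedin X (N q U)" "W q U \<subseteq> N q U" "N q U \<subseteq> U" using WN[of q U] U q(2) clX by auto
      have "r \<in> X closure_of (W r U' \<inter> S)"
        using openin_Int_closure_of_subset[OF WNr(1), of S] WNr(2) r by blast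
      also have "\<dots> \<subseteq> N q U"
        unfolding U'(2)[symmetric] using WNq by (intro closure_of_minimal) auto
      finally show ?thesis using WNq(3) by blast
    qed
    then show "r \<in> (\<Union>q\<in>Q. \<Inter>(\<O> q))" using q(1) by blast
  qed
  ultimately show ?thesis using that[of Q] Q clX by blast
qed

text \<open>
  Pytkeev's closing-off argument. The set \<open>A\<close> is closed under two operations on its small subsets
  \<open>S\<close>: it contains \<open>B q\<close> for each \<open>q\<close> used to cover the closure of \<open>S\<close>, and a point outside each
  finite union of open sets from these covers that is not the whole space. If \<open>y\<close> is not in the
  closure of \<open>A\<close>, then the closure of \<open>A\<close>, being the union of the closures of its small
  subsets, is covered by such open sets missing \<open>y\<close>. By compactness finitely many are enough, and then
  \<open>A\<close> contains a point outside them.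
\<close>

lemma small_dense_set:
  fixes X :: "'a topology" and \<kappa> :: "'k rel"
  assumes X: "compactum X" and \<kappa>: "Cinfinite \<kappa>" "regularCard \<kappa>" "pow_below \<kappa>"
    and tight: "\<And>A q. A \<subseteq> topspace X \<Longrightarrow> |A| \<le>o \<kappa> \<Longrightarrow> q \<in> X closure_of A \<Longrightarrow>
      \<exists>S\<subseteq>A. |S| <o \<kappa> \<and> q \<in> X closure_of S"
    and O: "\<And>q. q \<in> topspace X \<Longrightarrow> small_G X \<kappa> (\<O> q) \<and> q \<in> \<Inter>(\<O> q)"
    and B: "\<And>q. q \<in> topspace X \<Longrightarrow> B q \<subseteq> topspace X \<and> |B q| <o \<kappa> \<and>
      topspace X \<inter> \<Inter>(\<O> q) \<subseteq> X closure_of (B q)"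
  obtains A where "A \<subseteq> topspace X" "|A| \<le>o \<kappa>" "X closure_of A = topspace X"
proof -
  have "\<forall>S. \<exists>Q. |S| <o \<kappa> \<longrightarrow>
      Q \<subseteq> topspace X \<and> |Q| \<le>o \<kappa> \<and> X closure_of S \<subseteq> (\<Union>q\<in>Q. \<Inter>(\<O> q))"
    using closure_covered_by_few_small_G[OF X \<kappa> O] by metis
  then obtain Q where Q: "\<And>S. |S| <o \<kappa> \<Longrightarrow>
      Q S \<subseteq> topspace X \<and> |Q S| \<le>o \<kappa> \<and> X closure_of S \<subseteq> (\<Union>q\<in>Q S. \<Inter>(\<O> q))"
    by metis
  define \<U> where "\<U> S = (\<Union>T\<in>Pow S. \<Union>q\<in>Q T. \<O> q)" for S
  define pick where "pick F = (SOME z. z \<in> topspace X - \<Union>F)" for F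
  define \<F> where "\<F> S = {F \<in> Fpow (\<U> S). \<not> topspace X \<subseteq> \<Union>F}" for S
  define \<phi> where "\<phi> S = (\<Union>q\<in>Q S. B q) \<union> pick ` \<F> S" for S
  have pick: "pick F \<in> topspace X - \<Union>F" if "\<not> topspace X \<subseteq> \<Union>F" for F
    unfolding pick_def by (rule someI_ex) (use that in blast)
  have "|\<phi> S| \<le>o \<kappa>" if S: "|S| <o \<kappa>" for S
  proof -
    have 1: "|\<Union>q\<in>Q S. B q| \<le>o \<kappa>"
      using Q[OF S] B ordLess_imp_ordLeq by (intro UNION_Cinfinite_bound \<kappa>) blast+
    have "|\<U> S| \<le>o \<kappa>"
      unfolding \<U>_def
    proof (intro UNION_Cinfinite_bound[OF card_of_Pow_small[OF \<kappa> S] _ \<kappa>(1)] ballI)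
      fix T assume "T \<in> Pow S"
      then have T: "|T| <o \<kappa>" using S card_of_subset_ordLess by blast
      show "|\<Union>q\<in>Q T. \<O> q| \<le>o \<kappa>"
        using Q[OF T] O ordLess_imp_ordLeq unfolding small_G_def
        by (intro UNION_Cinfinite_bound \<kappa>) blast+
    qed
    then have "|Fpow (\<U> S)| \<le>o \<kappa>" by (rule card_of_Fpow_ordLeq_Cinfinite[OF \<kappa>(1)])
    then have "|\<F> S| \<le>o \<kappa>"
      by (rule card_of_subset_ordLeq[rotated]) (auto simp: \<F>_def)
    then show ?thesis
      unfolding \<phi>_def using 1 card_of_image_ordLeq by (intro Un_Cinfinite_bound \<kappa>) auto
  qed
  then obtain A0 where A0: "|A0| \<le>o \<kappa>" "\<And>S. S \<subseteq> A0 \<Longrightarrow> |S| <o \<kappa> \<Longrightarrow> \<phi> S \<subseteq> A0"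
    using closing_off[OF \<kappa>, of \<phi>] by metis
  \<comment> \<open>The closing-off lemma knows nothing of \<open>X\<close> and may return points outside of it.\<close>
  define A where "A = A0 \<inter> topspace X"
  have AX: "A \<subseteq> topspace X" by (simp add: A_def)
  have A: "\<phi> S \<subseteq> A" if S: "S \<subseteq> A" "|S| <o \<kappa>" for S
  proof -
    have "(\<Union>q\<in>Q S. B q) \<subseteq> topspace X" using Q[OF S(2)] B by blast
    moreover have "pick ` \<F> S \<subseteq> topspace X" using pick by (auto simp: \<F>_def)
    ultimately show ?thesis using A0(2)[of S] S by (auto simp: \<phi>_def A_def)
  qed
  have card: "|A| \<le>o \<kappa>" using card_of_subset_ordLeq[OF _ A0(1)] by (simp add: A_def)
  have "topspace X \<subseteq> X closure_of A"
  proof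
    fix y assume y: "y \<in> topspace X"
    show "y \<in> X closure_of A"
    proof (rule ccontr)
      assume ny: "y \<notin> X closure_of A"
      define \<A> where "\<A> = {U. y \<notin> U \<and> (\<exists>S q. S \<subseteq> A \<and> |S| <o \<kappa> \<and> q \<in> Q S \<and> U \<in> \<O> q)}"
      have "compactin X (X closure_of A)"
        using X by (intro closedin_compact_space) (auto simp: compactum_def)
      moreover have "openin X U" if "U \<in> \<A>" for U
        using that Q O unfolding \<A>_def small_G_def by blast
      moreover have "X closure_of A \<subseteq> \<Union>\<A>"
      proof
        fix z assume z: "z \<in> X closure_of A"
        then obtain S where S: "S \<subseteq> A" "|S| <o \<kappa>" "z \<in> X closure_of S"
          using tight[OF AX card] by blast
        then obtain q where q: "q \<in> Q S" "z \<in> \<Inter>(\<O> q)" using Q[OF S(2)] by blast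
        have "B q \<subseteq> A" using A[OF S(1,2)] q(1) by (auto simp: \<phi>_def)
        moreover have "q \<in> topspace X" using q(1) Q[OF S(2)] by blast
        ultimately have "topspace X \<inter> \<Inter>(\<O> q) \<subseteq> X closure_of A"
          using B[of q] closure_of_mono[of "B q" A X] by blast
        then obtain U where "U \<in> \<O> q" "y \<notin> U" using ny y by blast
        then show "z \<in> \<Union>\<A>" using q S unfolding \<A>_def by blast
      qed
      ultimately obtain F where F: "finite F" "F \<subseteq> \<A>" "X closure_of A \<subseteq> \<Union>F"
        unfolding compactin_def by metis
      have "\<forall>U\<in>F. \<exists>S. S \<subseteq> A \<and> |S| <o \<kappa> \<and> (\<exists>q\<in>Q S. U \<in> \<O> q)"
        using F(2) unfolding \<A>_def by blast
      then obtain s where s: "\<And>U. U \<in> F \<Longrightarrow> s U \<subseteq> A \<and> |s U| <o \<kappa> \<and> (\<exists>q\<in>Q (s U). U \<in> \<O> q)"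
        by metis
      define S where "S = (\<Union>U\<in>F. s U)"
      have "|S| <o \<kappa>"
        unfolding S_def using s finite_ordLess_Cinfinite[OF \<kappa>(1) F(1)]
        by (intro card_of_UNION_ordLess_infinite_Field_regularCard \<kappa>) auto
      moreover have "S \<subseteq> A" using s by (auto simp: S_def)
      ultimately have \<phi>: "\<phi> S \<subseteq> A" using A by blast
      have "F \<subseteq> \<U> S"
      proof
        fix U assume U: "U \<in> F"
        then have "s U \<in> Pow S" by (auto simp: S_def)
        then show "U \<in> \<U> S" using s[OF U] unfolding \<U>_def by blast
      qed
      moreover have nF: "\<not> topspace X \<subseteq> \<Union>F" using F(2) y by (auto simp: \<A>_def)
      ultimately have "F \<in> \<F> S" using F(1) by (simp add: \<F>_def Fpow_def)
      then have "pick F \<in> A" using \<phi> by (auto simp: \<phi>_def)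
      moreover have "pick F \<notin> \<Union>F" using pick[OF nF] by blast
      ultimately show False using F(3) closure_of_subset[OF AX] by blast
    qed
  qed
  then have "X closure_of A = topspace X" using closure_of_subset_topspace[of X A] by blast
  then show ?thesis using that AX card by blast
qed

text \<open>
  Fix for each \<open>q\<close> an autohomeomorphism \<open>h q\<close> moving \<open>p\<close> to \<open>q\<close>, and choose a point of \<open>A\<close> in each
  \<open>h q ` V\<close> with \<open>V\<close> in the \<open>\<pi>\<close>-base. These choices determine \<open>q\<close>: if \<open>q\<close> and \<open>r\<close> have
  disjoint neighbourhoods, then some \<open>V\<close> is moved into the first by \<open>h q\<close> and into the second by \<open>h r\<close>.
  The choices form a subset of \<open>\<V> \<times> A\<close> of size less than \<open>\<kappa>\<close>, and there are at most \<open>\<kappa>\<close> such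
  subsets.
\<close>

lemma homogeneous_card_le_of_dense:
  fixes X :: "'a topology" and \<kappa> :: "'k rel"
  assumes X: "Hausdorff_space X" "homogeneous X" "p \<in> topspace X"
    and \<kappa>: "Cinfinite \<kappa>" "regularCard \<kappa>" "pow_below \<kappa>"
    and A: "|A| \<le>o \<kappa>" "X closure_of A = topspace X"
    and V: "|\<V>| <o \<kappa>" "\<And>V. V \<in> \<V> \<Longrightarrow> openin X V \<and> V \<noteq> {}"
      "\<And>W. openin X W \<Longrightarrow> p \<in> W \<Longrightarrow> \<exists>V\<in>\<V>. V \<subseteq> W"
  shows "|topspace X| \<le>o \<kappa>"
proof -
  obtain h where h: "\<And>q. q \<in> topspace X \<Longrightarrow> homeomorphic_map X X (h q) \<and> h q p = q"
    using X(2,3) unfolding homogeneous_def by metis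
  have "\<exists>a. a \<in> A \<and> a \<in> h q ` V" if q: "q \<in> topspace X" and V1: "V \<in> \<V>" for q V
  proof -
    have "openin X (h q ` V)" "h q ` V \<noteq> {}"
      using V(2)[OF V1] h[OF q] homeomorphic_map_openness[of X X "h q" V] openin_subset by auto
    then show ?thesis using A(2) by (metis dense_intersects_open disjoint_iff)
  qed
  then obtain d where d: "\<And>q V. q \<in> topspace X \<Longrightarrow> V \<in> \<V> \<Longrightarrow> d q V \<in> A \<and> d q V \<in> h q ` V"
    by metis
  define g where "g q = (\<lambda>V. (V, d q V)) ` \<V>" for q
  have "inj_on g (topspace X)"
  proof (rule inj_onI, rule ccontr)
    fix q r assume q: "q \<in> topspace X" and r: "r \<in> topspace X" and eq: "g q = g r" and "q \<noteq> r"
    then obtain U W where UW: "openin X U" "openin X W" "q \<in> U" "r \<in> W" "disjnt U W"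
      using X(1) unfolding Hausdorff_space_def by metis
    define U' where "U' = {x \<in> topspace X. h q x \<in> U}"
    define W' where "W' = {x \<in> topspace X. h r x \<in> W}"
    have "continuous_map X X (h q)" "continuous_map X X (h r)"
      using h q r homeomorphic_imp_continuous_map by blast+
    then have "openin X (U' \<inter> W')"
      using UW unfolding U'_def W'_def by (intro openin_Int openin_continuous_map_preimage)
    moreover have "p \<in> U' \<inter> W'" using h q r UW X(3) by (auto simp: U'_def W'_def)
    ultimately obtain V where V1: "V \<in> \<V>" "V \<subseteq> U' \<inter> W'" using V(3) by blast
    have "d q V = d r V" using eq V1(1) by (auto simp: g_def)
    moreover have "d q V \<in> U" "d r V \<in> W"
      using d[OF q V1(1)] d[OF r V1(1)] V1(2) by (auto simp: U'_def W'_def)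
    ultimately show False using UW(5) by (auto simp: disjnt_def)
  qed
  moreover have "g ` topspace X \<subseteq> {S. S \<subseteq> \<V> \<times> A \<and> |S| <o \<kappa>}"
    using d card_of_image_ordLess[OF V(1)] by (auto simp: g_def)
  ultimately have "|topspace X| \<le>o |{S. S \<subseteq> \<V> \<times> A \<and> |S| <o \<kappa>}|"
    by (auto intro: card_of_ordLeqI)
  moreover have "|\<V> \<times> A| \<le>o \<kappa>"
    using card_of_Times_ordLeq_infinite_Field[of \<kappa> \<V> A] \<kappa>(1) A(1) V(1) ordLess_imp_ordLeq
    by (auto simp: cinfinite_def)
  ultimately show ?thesis
    using card_of_small_subsets[OF \<kappa>, of "\<V> \<times> A"] ordLeq_transitive by blast
qed

text \<open>
  If \<open>|A| = \<kappa>\<close>, enumerate \<open>A\<close> in order type \<open>\<kappa>\<close>: either \<open>q\<close> is in the closure of an initial segment, or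
  the enumeration yields an escape sequence.
\<close>

lemma no_escape_imp_small_tightness:
  assumes \<kappa>: "Cinfinite \<kappa>" and no_escape: "\<And>U. \<not> escape_seq X q \<kappa> U"
    and A: "A \<subseteq> topspace X" "|A| \<le>o \<kappa>" "q \<in> X closure_of A"
  shows "\<exists>S\<subseteq>A. |S| <o \<kappa> \<and> q \<in> X closure_of S"
proof (cases "|A| <o \<kappa>")
  case False
  then have "\<kappa> \<le>o |A|"
    using ordLess_or_ordLeq[OF card_of_Well_order Cinfinite_Well_order[OF \<kappa>], of A] by blast
  then have "|Field \<kappa>| =o |A|"
    using A(2) \<kappa> card_of_Field_ordIso ordIso_iff_ordLeq ordIso_transitive by metis
  then obtain a where a: "bij_betw a (Field \<kappa>) A" by (auto simp: card_of_ordIso[symmetric])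
  then have "inj_on a (Field \<kappa>)" "a ` Field \<kappa> = A" by (auto simp: bij_betw_def)
  then obtain i where i: "i \<in> Field \<kappa>" "q \<in> X closure_of (a ` underS \<kappa> i)"
    using escape_seq_of_enumeration[OF \<kappa>, of a X q] no_escape A(1,3) by metis
  have "|a ` underS \<kappa> i| <o \<kappa>" using card_of_image_ordLess card_underS_less[OF \<kappa> i(1)] .
  moreover have "a ` underS \<kappa> i \<subseteq> A"
    using \<open>a ` Field \<kappa> = A\<close> underS_Field_subset[of \<kappa> i] by blast
  ultimately show ?thesis using i(2) by blast
qed (use A in blast)

text \<open>
  Homogeneity moves the single pair \<open>\<O>\<close>, \<open>B\<close> to every point, as the closing-off argument requires.
\<close>

lemma homogeneous_card_le:
  fixes X :: "'a topology" and \<kappa> :: "'k rel"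
  assumes X: "compactum X" "homogeneous X" "p \<in> topspace X"
    and \<kappa>: "Cinfinite \<kappa>" "regularCard \<kappa>" "pow_below \<kappa>"
    and no_escape: "\<And>U. \<not> escape_seq X p \<kappa> U"
    and O: "small_G X \<kappa> \<O>" "topspace X \<inter> \<Inter>\<O> \<noteq> {}"
    and B: "B \<subseteq> topspace X" "|B| <o \<kappa>" "topspace X \<inter> \<Inter>\<O> \<subseteq> X closure_of B"
    and V: "|\<V>| <o \<kappa>" "\<And>V. V \<in> \<V> \<Longrightarrow> openin X V \<and> V \<noteq> {}"
      "\<And>W. openin X W \<Longrightarrow> p \<in> W \<Longrightarrow> \<exists>V\<in>\<V>. V \<subseteq> W"
  shows "|topspace X| \<le>o \<kappa>"
proof -
  obtain z where z: "z \<in> topspace X" "z \<in> \<Inter>\<O>" using O(2) by blast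
  obtain h where h: "\<And>q. q \<in> topspace X \<Longrightarrow> homeomorphic_map X X (h q) \<and> h q z = q"
    using X(2) z(1) unfolding homogeneous_def by metis
  have tight: "\<exists>S\<subseteq>A. |S| <o \<kappa> \<and> q \<in> X closure_of S"
    if "A \<subseteq> topspace X" "|A| \<le>o \<kappa>" "q \<in> X closure_of A" for A q
  proof (rule no_escape_imp_small_tightness[OF \<kappa>(1) _ that])
    have "q \<in> topspace X" using that(3) by (meson in_closure_of)
    then show "\<not> escape_seq X q \<kappa> U" for U
      using homogeneous_escape_seq[OF X(2) \<kappa>(1)] X(3) no_escape by metis
  qed
  obtain A where A: "A \<subseteq> topspace X" "|A| \<le>o \<kappa>" "X closure_of A = topspace X"
  proof (rule small_dense_set[OF X(1) \<kappa> tight, of "\<lambda>q. (`) (h q) ` \<O>" "\<lambda>q. h q ` B"])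
    fix q assume q: "q \<in> topspace X"
    have hq: "homeomorphic_map X X (h q)" "h q z = q" using h[OF q] by auto
    have "h q z \<in> \<Inter>((`) (h q) ` \<O>)" using z(2) by blast
    then show "small_G X \<kappa> ((`) (h q) ` \<O>) \<and> q \<in> \<Inter>((`) (h q) ` \<O>)"
      using homeomorphic_map_small_G(1)[OF hq(1) O(1)] hq(2) by simp
    have "h q ` B \<subseteq> topspace X" using B(1) homeomorphic_imp_surjective_map[OF hq(1)] by blast
    moreover have "X closure_of (h q ` B) = h q ` (X closure_of B)"
      using homeomorphic_map_closure_of[OF hq(1) B(1)] .
    ultimately show "h q ` B \<subseteq> topspace X \<and> |h q ` B| <o \<kappa> \<and>
        topspace X \<inter> \<Inter>((`) (h q) ` \<O>) \<subseteq> X closure_of (h q ` B)"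
      using homeomorphic_map_small_G(2)[OF hq(1) O(1)] B(3) card_of_image_ordLess[OF B(2)]
      by (simp add: image_mono)
  qed auto
  show ?thesis
    using homogeneous_card_le_of_dense[OF _ X(2,3) \<kappa> A(2,3) V] X(1) by (simp add: compactum_def)
qed

section \<open>Lengths of escape sequences\<close>

lemma escape_seq_antimono:
  assumes "Cinfinite \<kappa>" "escape_seq X p \<kappa> U" "(i, j) \<in> \<kappa>"
  shows "U j \<subseteq> U i"
  using assms(2,3) unfolding escape_seq_def by blast

text \<open>
  Otherwise the intersection would contain the neighbourhood \<open>b\<close>.
\<close>

lemma not_below_escape_seq:
  assumes \<kappa>: "Cinfinite \<kappa>" and U: "escape_seq X p \<kappa> U" and b: "b \<in> nbhds X p"
  obtains i where "i \<in> Field \<kappa>" "\<not> b \<subseteq> U i"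
proof (rule ccontr)
  assume "\<not> thesis"
  then have "b \<subseteq> (\<Inter>i\<in>Field \<kappa>. U i)" using that by blast
  moreover have "(\<Inter>i\<in>Field \<kappa>. U i) \<subseteq> topspace X"
    using U Cinfinite_Field_ne[OF \<kappa>] by (auto simp: escape_seq_def nbhds_def)
  ultimately show False using U b nbhds_mono by (metis escape_seq_def)
qed

lemma escape_imp_infinite_base:
  assumes "Cinfinite \<kappa>" "escape_seq X p \<kappa> U" "p \<in> topspace X" "cofinal_nbhds X p B"
  shows "infinite B"
proof
  assume "finite B"
  then have "topspace X \<inter> \<Inter>B \<in> nbhds X p"
    using assms(3,4) nbhds_Inter by (auto simp: cofinal_nbhds_def)
  then obtain i where i: "i \<in> Field \<kappa>" "\<not> topspace X \<inter> \<Inter>B \<subseteq> U i"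
    using not_below_escape_seq[OF assms(1,2)] by metis
  then have "U i \<in> nbhds X p" using assms(2) by (simp add: escape_seq_def)
  then show False using i(2) assms(4) unfolding cofinal_nbhds_def by blast
qed

text \<open>
  Each member of the base fails to be contained in some \<open>U i\<close>. If the base is small, these indices are
  bounded by some \<open>k\<close>, and then no member of the base is contained in \<open>U k\<close>.
\<close>

lemma regular_escape_base:
  assumes \<kappa>: "Cinfinite \<kappa>" "regularCard \<kappa>" and U: "escape_seq X p \<kappa> U"
    and B: "cofinal_nbhds X p B"
  shows "\<not> |B| <o \<kappa>"
proof
  assume card: "|B| <o \<kappa>"
  have "\<forall>b\<in>B. \<exists>i\<in>Field \<kappa>. \<not> b \<subseteq> U i"
  proof
    fix b assume "b \<in> B"
    then have "b \<in> nbhds X p" using B unfolding cofinal_nbhds_def by blast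
    then show "\<exists>i\<in>Field \<kappa>. \<not> b \<subseteq> U i" using not_below_escape_seq[OF \<kappa>(1) U] by metis
  qed
  then obtain i where i: "\<And>b. b \<in> B \<Longrightarrow> i b \<in> Field \<kappa> \<and> \<not> b \<subseteq> U (i b)" by metis
  then have "i ` B \<subseteq> Field \<kappa>" by blast
  then obtain k where k: "k \<in> Field \<kappa>" "i ` B \<subseteq> underS \<kappa> k"
    using regularCard_bounded[OF \<kappa> _ card_of_image_ordLess[OF card]] by metis
  have "U k \<in> nbhds X p" using U k(1) by (simp add: escape_seq_def)
  then obtain b where b: "b \<in> B" "b \<subseteq> U k" using B unfolding cofinal_nbhds_def by blast
  have "(i b, k) \<in> \<kappa>" using k(2) b(1) by (auto simp: underS_def)
  then show False using escape_seq_antimono[OF \<kappa>(1) U] b i by blast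
qed

text \<open>
  The points that disappear at the successor steps are distinct.
\<close>

lemma escape_length_le_card:
  assumes \<kappa>: "Cinfinite \<kappa>" and U: "escape_seq X p \<kappa> U"
  shows "\<kappa> \<le>o |topspace X|"
proof -
  have "\<exists>x. x \<in> U i \<and> (\<forall>j. i \<in> underS \<kappa> j \<longrightarrow> x \<notin> U j)" if i: "i \<in> Field \<kappa>" for i
  proof -
    obtain k where k: "k \<in> {k \<in> Field \<kappa>. i \<in> underS \<kappa> k}"
      "\<And>j. j \<in> {k \<in> Field \<kappa>. i \<in> underS \<kappa> k} \<Longrightarrow> (k, j) \<in> \<kappa>"
    proof (rule Cinfinite_least[OF \<kappa>, of "{k \<in> Field \<kappa>. i \<in> underS \<kappa> k}"])
      show "{k \<in> Field \<kappa>. i \<in> underS \<kappa> k} \<noteq> {}"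
        using Cinfinite_underS_greater[OF \<kappa> i] by blast
    qed auto
    then have "U k \<subset> U i" using U by (auto simp: escape_seq_def underS_def)
    then obtain x where x: "x \<in> U i" "x \<notin> U k" by blast
    have "x \<notin> U j" if "i \<in> underS \<kappa> j" for j
    proof -
      have "j \<in> Field \<kappa>" using that by (auto simp: underS_def Field_def)
      then have "U j \<subseteq> U k" using k(2) that escape_seq_antimono[OF \<kappa> U] by blast
      then show ?thesis using x(2) by blast
    qed
    then show ?thesis using x(1) by blast
  qed
  then obtain x where x: "\<And>i. i \<in> Field \<kappa> \<Longrightarrow> x i \<in> U i"
    "\<And>i j. i \<in> Field \<kappa> \<Longrightarrow> i \<in> underS \<kappa> j \<Longrightarrow> x i \<notin> U j" by metis
  have "inj_on x (Field \<kappa>)"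
  proof (rule inj_onI, rule ccontr)
    fix i j assume ij: "i \<in> Field \<kappa>" "j \<in> Field \<kappa>" "x i = x j" "i \<noteq> j"
    then have "i \<in> underS \<kappa> j \<or> j \<in> underS \<kappa> i"
      using underS_cases[OF \<kappa> ij(1,2)] by (auto simp: underS_def)
    then show False using x ij by metis
  qed
  moreover have "x i \<in> topspace X" if "i \<in> Field \<kappa>" for i
    using x(1)[OF that] U that by (auto simp: escape_seq_def nbhds_def)
  ultimately have "|Field \<kappa>| \<le>o |topspace X|" by (auto intro: card_of_ordLeqI)
  moreover have "\<kappa> =o |Field \<kappa>|" using \<kappa> card_of_Field_ordIso ordIso_symmetric by blast
  ultimately show ?thesis by (rule ordIso_ordLeq_trans[rotated])
qed

text \<open>
  With \<open>\<nu>\<close> the successor of \<open>|B|\<close>, the interiors of the members of \<open>B\<close> are both a \<open>\<pi>\<close>-base at \<open>p\<close> and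
  a \<open>G\<^bsub><\<nu>\<^esub>\<close> representation of \<open>{p}\<close>, so the cardinality bound holds for \<open>\<nu>\<close>. This is how singular
  lengths above \<open>|B|\<close> are excluded: \<open>|B| < \<kappa>\<close> leaves only \<open>\<kappa> = \<nu>\<close>, which is regular.
\<close>

lemma escape_le_base:
  fixes X :: "'a topology"
  assumes X: "compactum X" "homogeneous X" "p \<in> topspace X"
    and \<kappa>: "Cinfinite \<kappa>" and U: "escape_seq X p \<kappa> U" and B: "cofinal_nbhds X p B"
    and pow: "pow_below (cardSuc |B| )"
  shows "\<kappa> \<le>o |B|"
proof (rule ccontr)
  assume "\<not> \<kappa> \<le>o |B|"
  then have less: "|B| <o \<kappa>"
    using ordLess_or_ordLeq[OF card_of_Well_order Cinfinite_Well_order[OF \<kappa>], of B] by blast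
  have inf: "infinite B" using escape_imp_infinite_base[OF \<kappa> U X(3) B] .
  let ?\<nu> = "cardSuc |B|"
  have BC: "Cinfinite |B|" using Cinfinite_card_of[OF inf] .
  have \<nu>: "Cinfinite ?\<nu>" "regularCard ?\<nu>" "|B| <o ?\<nu>"
    using Cinfinite_cardSuc[OF BC] regularCard_cardSuc[OF BC] cardSuc_greater[OF card_of_Card_order]
    by auto
  have "?\<nu> \<le>o \<kappa>" using cardSuc_least[OF card_of_Card_order _ less] \<kappa> by blast
  have Bn: "b \<subseteq> topspace X" "p \<in> X interior_of b" if "b \<in> B" for b
    using B that by (auto simp: cofinal_nbhds_def nbhds_def)
  define \<O> where "\<O> = (\<lambda>b. X interior_of b) ` B"
  have base: "\<exists>V\<in>\<O>. V \<subseteq> W" if "openin X W" "p \<in> W" for W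
  proof -
    have "W \<in> nbhds X p" using open_in_nbhds that by metis
    then obtain b where "b \<in> B" "b \<subseteq> W" using B by (auto simp: cofinal_nbhds_def)
    then show ?thesis using interior_of_subset[of X b] by (auto simp: \<O>_def)
  qed
  have op: "openin X V \<and> p \<in> V" if "V \<in> \<O>" for V using that Bn by (auto simp: \<O>_def)
  have card: "|\<O>| <o ?\<nu>" unfolding \<O>_def using card_of_image_ordLess[OF \<nu>(3)] .
  have "topspace X \<inter> \<Inter>\<O> \<subseteq> {p}"
  proof
    fix y assume y: "y \<in> topspace X \<inter> \<Inter>\<O>"
    show "y \<in> {p}"
    proof (rule ccontr)
      assume "y \<notin> {p}"
      then have "openin X (topspace X - {y})" "p \<in> topspace X - {y}"
        using X(1,3) y Hausdorff_imp_t1_space t1_space_openin_delete_alt[of X]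
        by (auto simp: compactum_def)
      then show False using base y by blast
    qed
  qed
  then have I: "topspace X \<inter> \<Inter>\<O> = {p}" using op X(3) by blast
  have "|topspace X| \<le>o ?\<nu>"
  proof (rule homogeneous_card_le[OF X \<nu>(1,2) pow, of \<O> "{p}" \<O>])
    show "\<not> escape_seq X p ?\<nu> V" for V using regular_escape_base[OF \<nu>(1,2) _ B] \<nu>(3) by blast
    show "small_G X ?\<nu> \<O>" using card op by (simp add: small_G_def)
    show "topspace X \<inter> \<Inter>\<O> \<noteq> {}" "{p} \<subseteq> topspace X" using I X(3) by auto
    show "topspace X \<inter> \<Inter>\<O> \<subseteq> X closure_of {p}"
      unfolding I using X(3) by (intro closure_of_subset) simp
    show "|{p}| <o ?\<nu>" by (intro finite_ordLess_Cinfinite \<nu>) simp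
  qed (use card op base in auto)
  then have "\<kappa> \<le>o ?\<nu>" using escape_length_le_card[OF \<kappa> U] ordLeq_transitive by metis
  then have "?\<nu> =o \<kappa>" using \<open>?\<nu> \<le>o \<kappa>\<close> ordIso_iff_ordLeq by metis
  then have "regularCard \<kappa>" using regularCard_ordIso \<nu>(1,2) by metis
  then show False using regular_escape_base[OF \<kappa> _ U B] less by blast
qed

text \<open>
  The contrapositive says that uncountable regular cardinals up to the character are lengths. The bound \<open>|X| \<le> \<kappa>\<close> makes the diagonal
  argument produce one point of small character, which homogeneity moves to \<open>p\<close>.
\<close>

lemma small_base_if_no_escape:
  fixes X :: "'a topology" and \<kappa> :: "'k rel"
  assumes X: "compactum X" "homogeneous X" "p \<in> topspace X"
    and \<kappa>: "Cinfinite \<kappa>" "regularCard \<kappa>" "pow_below \<kappa>" "natLeq <o \<kappa>"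
    and no_escape: "\<And>U. \<not> escape_seq X p \<kappa> U"
  obtains B where "cofinal_nbhds X p B" "|B| <o \<kappa>"
proof -
  have ne: "topspace X \<noteq> {}" using X(3) by blast
  have no_free: "\<not> free_seq X \<kappa> x" for x
    using free_seq_escape[OF _ \<kappa>(1)] homogeneous_escape_seq[OF X(2) \<kappa>(1)] X(1,3) no_escape
    unfolding compactum_def by metis
  obtain \<O> D where O: "small_G X \<kappa> \<O>" "topspace X \<inter> \<Inter>\<O> \<noteq> {}"
    and D: "D \<subseteq> topspace X" "|D| <o \<kappa>" "topspace X \<inter> \<Inter>\<O> \<subseteq> X closure_of D"
    by (rule small_G_in_closure[OF X(1) ne \<kappa>(1,2,4) no_free])
  obtain \<V> where V: "|\<V>| <o \<kappa>" "\<And>V. V \<in> \<V> \<Longrightarrow> openin X V \<and> V \<noteq> {}"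
    "\<And>W. openin X W \<Longrightarrow> p \<in> W \<Longrightarrow> \<exists>V\<in>\<V>. V \<subseteq> W"
    by (rule small_local_pi_base[OF X(1,3) \<kappa>(1,2) no_free]) blast
  have "|topspace X| \<le>o \<kappa>"
    by (rule homogeneous_card_le[OF X \<kappa>(1-3) no_escape O D V])
  then obtain q \<U> where q: "q \<in> topspace X" "small_G X \<kappa> \<U>" "topspace X \<inter> \<Inter>\<U> = {q}"
    by (rule small_compactum_has_small_G_point[OF X(1) ne \<kappa>(1,2,4)])
  obtain h where h: "homeomorphic_map X X h" "h q = p"
    using X(2,3) q(1) unfolding homogeneous_def by metis
  have "topspace X \<inter> \<Inter>((`) h ` \<U>) = {p}"
    using homeomorphic_map_small_G(2)[OF h(1) q(2)] q(3) h(2) by simp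
  then show ?thesis
    using small_G_point_character[OF X(1) \<kappa>(1) homeomorphic_map_small_G(1)[OF h(1) q(2)]] that by metis
qed

text \<open>
  A countably infinite set has an accumulation point, which lies in the closure of none of its
  finite subsets that omit it.
\<close>

lemma countable_escape:
  fixes X :: "'a topology"
  assumes X: "compactum X" "infinite (topspace X)" and \<kappa>: "Cinfinite \<kappa>" "\<not> natLeq <o \<kappa>"
  obtains q U where "q \<in> topspace X" "escape_seq X q \<kappa> U"
proof -
  have t1: "t1_space X" using X(1) Hausdorff_imp_t1_space by (auto simp: compactum_def)
  have "\<kappa> \<le>o natLeq"
    using ordLess_or_ordLeq[OF natLeq_Well_order Cinfinite_Well_order[OF \<kappa>(1)]] \<kappa>(2) by blast
  then have le: "\<kappa> \<le>o |A|" if "infinite A" for A :: "'a set"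
    using that infinite_iff_natLeq_ordLeq ordLeq_transitive by blast
  obtain b where b: "inj_on b (Field \<kappa>)" "b ` Field \<kappa> \<subseteq> topspace X"
    using inj_from_Field[OF _ le[OF X(2)]] \<kappa>(1) by blast
  have "infinite (b ` Field \<kappa>)" using b(1) \<kappa>(1) finite_imageD by (auto simp: cinfinite_def)
  moreover have "compactin X (topspace X)" using X(1) by (simp add: compactum_def compact_space_def)
  ultimately obtain q where q: "q \<in> X derived_set_of (b ` Field \<kappa>)"
    using compactin_imp_Bolzano_Weierstrass[of X "topspace X" "b ` Field \<kappa>"] b(2) by blast
  define A where "A = b ` Field \<kappa> - {q}"
  have qA: "q \<in> X closure_of A" using q unfolding A_def derived_set_of_def closure_of_def by blast
  have "infinite A" using \<open>infinite (b ` Field \<kappa>)\<close> by (simp add: A_def)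
  have "|A| \<le>o |Field \<kappa>|"
    by (rule card_of_subset_ordLeq[OF _ card_of_image]) (auto simp: A_def)
  moreover have "|Field \<kappa>| \<le>o |A|"
    using le[OF \<open>infinite A\<close>] card_of_Field_ordIso \<kappa>(1) ordIso_ordLeq_trans by blast
  ultimately obtain a where "bij_betw a (Field \<kappa>) A"
    using card_of_ordIso ordIso_iff_ordLeq by metis
  then have a: "inj_on a (Field \<kappa>)" "a ` Field \<kappa> = A" by (auto simp: bij_betw_def)
  have AX: "A \<subseteq> topspace X" using b(2) by (auto simp: A_def)
  have "q \<notin> X closure_of (a ` underS \<kappa> i)" if i: "i \<in> Field \<kappa>" for i
  proof -
    have "|underS \<kappa> i| <o natLeq"
      using card_underS_less[OF \<kappa>(1) i] \<open>\<kappa> \<le>o natLeq\<close> ordLess_ordLeq_trans by blast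
    then have "finite (a ` underS \<kappa> i)" using finite_iff_ordLess_natLeq by blast
    moreover have sub: "a ` underS \<kappa> i \<subseteq> A" using a(2) underS_Field_subset[of \<kappa> i] by blast
    ultimately have "closedin X (a ` underS \<kappa> i)"
      using t1 AX unfolding t1_space_closedin_finite by blast
    then have "X closure_of (a ` underS \<kappa> i) \<subseteq> A" using sub by (simp add: closure_of_closedin)
    then show ?thesis by (auto simp: A_def)
  qed
  then have "escape_seq X q \<kappa> (\<lambda>i. topspace X - a ` underS \<kappa> i)"
    using a qA AX by (intro escape_seq_of_enumeration \<kappa>) auto
  moreover have "q \<in> topspace X" using qA by (meson in_closure_of)
  ultimately show ?thesis using that by blast
qed

text \<open>
  By homogeneity and compactness finitely many copies of \<open>W\<close> cover the space.
\<close>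

lemma open_set_has_full_card:
  assumes X: "compact_space X" "homogeneous X" "infinite (topspace X)"
    and W: "openin X W" "z \<in> W"
  shows "|topspace X| \<le>o |W|"
proof -
  have WX: "W \<subseteq> topspace X" using W(1) openin_subset by blast
  obtain h where h: "\<And>q. q \<in> topspace X \<Longrightarrow> homeomorphic_map X X (h q) \<and> h q z = q"
    using X(2) W(2) WX unfolding homogeneous_def by (metis subsetD)
  have "\<exists>F. finite F \<and> F \<subseteq> (\<lambda>q. h q ` W) ` topspace X \<and> topspace X \<subseteq> \<Union>F"
  proof -
    have "openin X U" if "U \<in> (\<lambda>q. h q ` W) ` topspace X" for U
      using that h homeomorphic_map_openness[OF _ WX] W(1) by blast
    moreover have "topspace X \<subseteq> \<Union>((\<lambda>q. h q ` W) ` topspace X)"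
    proof
      fix q assume q: "q \<in> topspace X"
      have "h q z \<in> h q ` W" using W(2) by blast
      then have "q \<in> h q ` W" using h[OF q] by simp
      then show "q \<in> \<Union>((\<lambda>q. h q ` W) ` topspace X)" using q by blast
    qed
    ultimately show ?thesis using X(1) unfolding compact_space_def compactin_def by metis
  qed
  then obtain F where "finite F" "F \<subseteq> (\<lambda>q. h q ` W) ` topspace X" "topspace X \<subseteq> \<Union>F" by blast
  then obtain Q where Q: "finite Q" "topspace X \<subseteq> (\<Union>q\<in>Q. h q ` W)"
    by (metis finite_subset_image)
  have inf: "infinite W"
  proof
    assume "finite W"
    then have "finite (\<Union>q\<in>Q. h q ` W)" using Q(1) by blast
    then show False using Q(2) X(3) finite_subset by blast
  qed
  have "|\<Union>q\<in>Q. h q ` W| \<le>o |W|"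
  proof (rule card_of_UNION_ordLeq_infinite[OF inf])
    show "|Q| \<le>o |W|"
      by (rule ordLess_imp_ordLeq[OF finite_ordLess_Cinfinite[OF Cinfinite_card_of[OF inf] Q(1)]])
    show "\<forall>q\<in>Q. |h q ` W| \<le>o |W|" using card_of_image by blast
  qed
  then show ?thesis using card_of_subset_ordLeq[OF Q(2)] by blast
qed

text \<open>
  Let \<open>i \<alpha>\<close> be the least element of \<open>K\<close>, in the order \<open>|K|\<close>, that bounds \<open>\<alpha>\<close> from above. The
  sequence \<open>U (i \<alpha>)\<close> is decreasing but constant for long stretches. Adding \<open>E\<close> to all members and
  removing its points \<open>e \<alpha>\<close> one at a time makes the inclusions proper. As \<open>p\<close> is not in the closure
  of \<open>E\<close>, this does not matter near \<open>p\<close>, neither for being a neighbourhood nor for the intersection.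
  The minimality of \<open>|K|\<close> makes the indices \<open>i \<alpha>\<close> cofinal in \<open>|K|\<close>.
\<close>

lemma singular_escape:
  fixes X :: "'a topology" and \<kappa> :: "'k rel" and K :: "'k set"
  assumes \<kappa>: "Cinfinite \<kappa>" and K: "K \<subseteq> Field \<kappa>" "cofinal K \<kappa>" "infinite K"
    and min: "\<And>L. L \<subseteq> Field \<kappa> \<Longrightarrow> |L| <o |K| \<Longrightarrow> \<not> cofinal L \<kappa>"
    and U: "escape_seq X p |K| U"
    and p: "p \<in> topspace X"
    and E: "E \<subseteq> topspace X" "p \<notin> X closure_of E" "\<kappa> \<le>o |E|"
  obtains V where "escape_seq X p \<kappa> V"
proof -
  have KC: "Cinfinite |K|" using Cinfinite_card_of[OF K(3)] .
  obtain e where e: "inj_on e (Field \<kappa>)" "e ` Field \<kappa> \<subseteq> E"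
    using inj_from_Field[OF _ E(3)] \<kappa> by blast
  have "\<exists>m. m \<in> {j \<in> K. (\<alpha>, j) \<in> \<kappa>} \<and> (\<forall>j\<in>{j \<in> K. (\<alpha>, j) \<in> \<kappa>}. (m, j) \<in> |K| )"
    if "\<alpha> \<in> Field \<kappa>" for \<alpha>
  proof -
    have "{j \<in> K. (\<alpha>, j) \<in> \<kappa>} \<noteq> {}" using K(2) that unfolding cofinal_def by blast
    then show ?thesis
      using Cinfinite_least[OF KC, of "{j \<in> K. (\<alpha>, j) \<in> \<kappa>}"] by (auto simp: Field_card_of)
  qed
  then obtain i where i: "\<And>\<alpha>. \<alpha> \<in> Field \<kappa> \<Longrightarrow> i \<alpha> \<in> K \<and> (\<alpha>, i \<alpha>) \<in> \<kappa>"
    and i_least: "\<And>\<alpha> j. \<alpha> \<in> Field \<kappa> \<Longrightarrow> j \<in> K \<Longrightarrow> (\<alpha>, j) \<in> \<kappa> \<Longrightarrow> (i \<alpha>, j) \<in> |K|"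
    by (metis (mono_tags, lifting) mem_Collect_eq)
  define V where "V \<alpha> = (U (i \<alpha>) \<union> E) - e ` underS \<kappa> \<alpha>" for \<alpha>
  have Un: "U j \<in> nbhds X p" if "j \<in> K" for j
    using U that by (simp add: escape_seq_def Field_card_of)
  have En: "topspace X - E \<in> nbhds X p" using E(2) nbhds_complement[OF p] by blast
  have eE: "e ` underS \<kappa> \<alpha> \<subseteq> E" for \<alpha> using e(2) underS_Field_subset[of \<kappa> \<alpha>] by blast
  have nb: "V \<alpha> \<in> nbhds X p" if \<alpha>: "\<alpha> \<in> Field \<kappa>" for \<alpha>
  proof (rule nbhds_mono)
    show "U (i \<alpha>) \<inter> (topspace X - E) \<in> nbhds X p" by (intro nbhds_Int Un En) (use i[OF \<alpha>] in simp)
    show "U (i \<alpha>) \<inter> (topspace X - E) \<subseteq> V \<alpha>" using eE[of \<alpha>] by (auto simp: V_def)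
    have "U (i \<alpha>) \<subseteq> topspace X" using Un i[OF \<alpha>] by (simp add: nbhds_def)
    then show "V \<alpha> \<subseteq> topspace X" using E(1) by (auto simp: V_def)
  qed
  have strict: "V \<beta> \<subset> V \<alpha>" if \<alpha>\<beta>: "(\<alpha>, \<beta>) \<in> \<kappa>" "\<alpha> \<noteq> \<beta>" for \<alpha> \<beta>
  proof -
    have F: "\<alpha> \<in> Field \<kappa>" "\<beta> \<in> Field \<kappa>" using \<alpha>\<beta> by (auto simp: Field_def)
    have "(\<alpha>, i \<beta>) \<in> \<kappa>" using Cinfinite_trans[OF \<kappa> \<alpha>\<beta>(1)] i[OF F(2)] by blast
    then have "(i \<alpha>, i \<beta>) \<in> |K|" using i_least[OF F(1)] i[OF F(2)] by blast
    then have "U (i \<beta>) \<subseteq> U (i \<alpha>)" using escape_seq_antimono[OF KC U] by blast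
    moreover have "underS \<kappa> \<alpha> \<subseteq> underS \<kappa> \<beta>" using underS_trans_eq[OF \<kappa> _ \<alpha>\<beta>(1)] by blast
    moreover have "e \<alpha> \<notin> e ` underS \<kappa> \<alpha>"
      using e(1) F(1) underS_Field_subset[of \<kappa> \<alpha>]
      by (simp add: inj_on_image_mem_iff) (simp add: underS_def)
    moreover have "\<alpha> \<in> underS \<kappa> \<beta>" using \<alpha>\<beta> by (simp add: underS_def)
    moreover have "e \<alpha> \<in> E" using e(2) F(1) by blast
    ultimately show ?thesis unfolding V_def by blast
  qed
  have "(\<Inter>\<alpha>\<in>Field \<kappa>. V \<alpha>) \<notin> nbhds X p"
  proof
    assume "(\<Inter>\<alpha>\<in>Field \<kappa>. V \<alpha>) \<in> nbhds X p"
    then have "(\<Inter>\<alpha>\<in>Field \<kappa>. V \<alpha>) \<inter> (topspace X - E) \<in> nbhds X p"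
      using En by (rule nbhds_Int)
    then obtain j where j: "j \<in> K" "\<not> (\<Inter>\<alpha>\<in>Field \<kappa>. V \<alpha>) \<inter> (topspace X - E) \<subseteq> U j"
      using not_below_escape_seq[OF KC U] by (metis Field_card_of)
    have "underS |K| j \<subseteq> Field \<kappa>" using K(1) underS_Field_subset[of "|K|" j] by (auto simp: Field_card_of)
    moreover have "|underS |K| j| <o |K|" using card_underS_less[OF KC] j(1) by (simp add: Field_card_of)
    ultimately obtain k where k: "k \<in> Field \<kappa>" "underS |K| j \<subseteq> underS \<kappa> k"
      using not_cofinal_imp_bounded[OF \<kappa>] min by metis
    have "i k \<notin> underS \<kappa> k"
      using i[OF k(1)] Cinfinite_antisym[OF \<kappa>, of k "i k"] by (auto simp: underS_def)
    then have "(j, i k) \<in> |K|"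
      using underS_cases[OF KC, of "i k" j] k(2) i[OF k(1)] j(1) by (auto simp: Field_card_of)
    then have "U (i k) \<subseteq> U j" using escape_seq_antimono[OF KC U] by blast
    then show False using j(2) k(1) by (auto simp: V_def)
  qed
  then have "escape_seq X p \<kappa> V" using nb strict by (auto simp: escape_seq_def)
  then show ?thesis using that by blast
qed

text \<open>
  The complements of the other points are at most \<open>|X|\<close> open sets that intersect in \<open>{p}\<close>.
\<close>

lemma card_ge_base:
  fixes X :: "'a topology" and \<kappa> :: "'k rel"
  assumes X: "compactum X" "p \<in> topspace X" and \<kappa>: "Cinfinite \<kappa>"
    and base: "\<And>B. cofinal_nbhds X p B \<Longrightarrow> \<not> |B| <o \<kappa>"
  shows "\<kappa> \<le>o |topspace X|"
proof (rule ccontr)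
  assume "\<not> \<kappa> \<le>o |topspace X|"
  then have less: "|topspace X| <o \<kappa>"
    using ordLess_or_ordLeq[OF card_of_Well_order Cinfinite_Well_order[OF \<kappa>], of "topspace X"] by blast
  define \<O> where "\<O> = (\<lambda>q. topspace X - {q}) ` (topspace X - {p})"
  have "small_G X \<kappa> \<O>"
    unfolding small_G_def
  proof
    show "|\<O>| <o \<kappa>"
      unfolding \<O>_def by (intro card_of_image_ordLess card_of_subset_ordLess[OF _ less]) blast
    show "\<forall>U\<in>\<O>. openin X U"
      using X(1) Hausdorff_imp_t1_space t1_space_openin_delete_alt[of X]
      by (auto simp: \<O>_def compactum_def)
  qed
  moreover have "topspace X \<inter> \<Inter>\<O> = {p}" using X(2) by (auto simp: \<O>_def)
  ultimately show False using small_G_point_character[OF X(1) \<kappa>] base by metis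
qed

text \<open>
  Only the singular case uses the induction hypothesis, for the cofinality of \<open>\<kappa>\<close>.
\<close>

lemma escape_of_every_small_length:
  fixes X :: "'a topology" and \<kappa> :: "'a set rel"
  assumes GCH: "GCH TYPE('a set set)"
    and X: "compactum X" "homogeneous X" "p \<in> topspace X" "infinite (topspace X)"
    and B: "\<And>C. cofinal_nbhds X p C \<Longrightarrow> |B| \<le>o |C|"
    and \<kappa>: "Cinfinite \<kappa>" "\<kappa> \<le>o |B|"
  shows "\<exists>U. escape_seq X p \<kappa> U"
  using \<kappa>
proof (induction \<kappa> rule: wf_induct_rule[OF wf_ordLess])
  case (1 \<kappa>)
  note \<kappa> = \<open>Cinfinite \<kappa>\<close>
  have base: "\<not> |C| <o \<kappa>" if "cofinal_nbhds X p C" for C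
    using B[OF that] 1(3) ordLeq_transitive not_ordLess_ordLeq by metis
  show ?case
  proof (cases "natLeq <o \<kappa>")
    case False
    then show ?thesis
      using countable_escape[OF X(1,4) \<kappa>] homogeneous_escape_seq[OF X(2) \<kappa>] X(3) by metis
  next
    case uncountable: True
    show ?thesis
    proof (cases "regularCard \<kappa>")
      case True
      have "pow_below \<kappa>"
        using GCH_pow_below[OF GCH \<kappa>, of "\<lambda>x. {x}"] by simp
      then show ?thesis
        using small_base_if_no_escape[OF X(1-3) \<kappa> True _ uncountable] base by metis
    next
      case False
      let ?K = "{K. K \<subseteq> Field \<kappa> \<and> cofinal K \<kappa>}"
      obtain L where L: "L \<subseteq> Field \<kappa>" "cofinal L \<kappa>" "\<not> |L| =o \<kappa>"
        using False unfolding regularCard_def by blast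
      have "\<exists>r\<in>card_of ` ?K. \<forall>r'\<in>card_of ` ?K. r \<le>o r'"
        using L(1,2) by (intro exists_minim_Card_order) (auto simp: card_of_Card_order)
      then obtain K where K: "K \<subseteq> Field \<kappa>" "cofinal K \<kappa>"
        and min: "\<And>M. M \<subseteq> Field \<kappa> \<Longrightarrow> cofinal M \<kappa> \<Longrightarrow> |K| \<le>o |M|" by auto
      have "|L| \<le>o \<kappa>" using card_of_subset_ordLeq[OF L(1) card_Field_ordLeq[OF \<kappa>]] .
      then have "|L| <o \<kappa>" using L(3) ordLeq_iff_ordLess_or_ordIso by blast
      then have less: "|K| <o \<kappa>" using min[OF L(1,2)] ordLeq_ordLess_trans by blast
      have inf: "infinite K"
      proof
        assume fin: "finite K"
        have "K \<noteq> {}" using K(2) Cinfinite_Field_ne[OF \<kappa>] unfolding cofinal_def by blast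
        then obtain k where k: "k \<in> K" "\<And>i. i \<in> K \<Longrightarrow> (i, k) \<in> \<kappa>"
          using finite_subset_has_max[OF \<kappa> fin K(1)] by metis
        then obtain b where b: "b \<in> K" "k \<noteq> b" "(k, b) \<in> \<kappa>"
          using K unfolding cofinal_def by blast
        then show False using Cinfinite_antisym[OF \<kappa> b(3)] k(2) by blast
      qed
      have KC: "Cinfinite |K|" using Cinfinite_card_of[OF inf] .
      have "|K| \<le>o |B|" using less 1(3) ordLess_imp_ordLeq ordLeq_transitive by blast
      then obtain U where U: "escape_seq X p |K| U" using 1(1)[OF less KC] by blast
      obtain q where q: "q \<in> topspace X" "q \<noteq> p"
        using X(4) by (metis finite.emptyI finite_insert finite_subset insertI1 subsetI)
      then obtain W W' where W: "openin X W" "openin X W'" "q \<in> W" "p \<in> W'" "disjnt W W'"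
        using X(1,3) unfolding compactum_def Hausdorff_space_def by metis
      have "p \<notin> X closure_of W" using W(2,4,5) by (auto simp: in_closure_of disjnt_def)
      moreover have "\<kappa> \<le>o |W|"
        using card_ge_base[OF X(1,3) \<kappa> base] open_set_has_full_card[OF _ X(2,4) W(1,3)] X(1)
          ordLeq_transitive unfolding compactum_def by blast
      moreover have "\<not> cofinal M \<kappa>" if "M \<subseteq> Field \<kappa>" "|M| <o |K|" for M
        using min that not_ordLess_ordLeq by blast
      ultimately show ?thesis
        using singular_escape[OF \<kappa> K inf _ U X(3), of W] openin_subset[OF W(1)] by metis
    qed
  qed
qed

theorem theorem3p18:
  fixes X :: "'a topology" and p :: 'a
  assumes "GCH TYPE('a set set)"
    and "compactum X" and "homogeneous X" and "p \<in> topspace X"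
  shows "card_initial_segment (Escape X p) \<and> card_closed (Escape X p) \<and>
    (infinite (topspace X) \<longrightarrow> card_maximum (Escape X p) (character X p))"
proof (cases "finite (topspace X)")
  case True
  have "cofinal_nbhds X p (nbhds X p)" by (auto simp: cofinal_nbhds_def)
  moreover have "finite (nbhds X p)"
    by (rule finite_subset[of _ "Pow (topspace X)"]) (use True in \<open>auto simp: nbhds_def\<close>)
  ultimately have "Escape X p = {}"
    using escape_imp_infinite_base[OF _ _ assms(4)] by (fastforce simp: Escape_def)
  then show ?thesis using True by (auto simp: card_initial_segment_def card_closed_def)
next
  case inf: False
  obtain B where B: "cofinal_nbhds X p B" "character X p = |B|"
    "\<And>C. cofinal_nbhds X p C \<Longrightarrow> |B| \<le>o |C|"
    using character_attained[of X p] by blast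
  obtain q and U :: "nat \<Rightarrow> 'a set" where "q \<in> topspace X" "escape_seq X q natLeq U"
    using countable_escape[OF assms(2) inf natLeq_Cinfinite] ordLess_irreflexive by metis
  then obtain V where "escape_seq X p natLeq V"
    using homogeneous_escape_seq[OF assms(3) natLeq_Cinfinite] assms(4) by metis
  then have "infinite B"
    using escape_imp_infinite_base[OF natLeq_Cinfinite _ assms(4) B(1)] by blast
  then have BC: "Cinfinite |B|" by (rule Cinfinite_card_of)
  have pow: "pow_below (cardSuc |B| )"
    using GCH_pow_below[OF assms(1) Cinfinite_cardSuc[OF BC], of id] by simp
  have Escape: "Escape X p = {\<kappa>. Cinfinite \<kappa> \<and> \<kappa> \<le>o |B| }"
    using escape_le_base[OF assms(2-4) _ _ B(1) pow]
      escape_of_every_small_length[OF assms inf B(3)]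
    unfolding Escape_def by blast
  have "card_initial_segment (Escape X p)"
    unfolding card_initial_segment_def Escape using ordLeq_transitive by blast
  moreover have "card_closed (Escape X p)"
    unfolding card_closed_def
  proof (intro allI impI)
    fix T :: "'a set rel set" and \<mu> :: "'a set rel"
    assume T: "T \<subseteq> Escape X p \<and> T \<noteq> {} \<and> card_lub T \<mu>"
    then obtain \<kappa> where \<kappa>: "\<kappa> \<in> T" "Cinfinite \<kappa>" unfolding Escape by blast
    have "\<kappa> \<le>o \<mu>" "Card_order \<mu>" using T \<kappa>(1) by (auto simp: card_lub_def)
    then have "Cinfinite \<mu>" using cinfinite_mono \<kappa>(2) by blast
    moreover have "\<mu> \<le>o |B|"
      using T card_of_Card_order[of B] unfolding card_lub_def Escape by blast
    ultimately show "\<mu> \<in> Escape X p" unfolding Escape by blast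
  qed
  moreover have "card_maximum (Escape X p) (character X p)"
    unfolding card_maximum_def Escape B(2) using BC ordLeq_refl[OF card_of_Card_order] by blast
  ultimately show ?thesis by blast
qed

end
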